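(* The Local Days On Days Off Scheduling Problem (LDODOSP) can be decided in $\mathcal{O}(D^2)$ time.
   Context: An instance of the Days On Days Off Scheduling Problem (DODOSP) consists of integers $D\ge 1$ (days), $N\ge 1$ (workers), bounds $l_w,u_w,l_o,u_o,U_w,U_o\in\mathbb{N}$, and for each day $d\in\{1,\dots,D\}$ integers $0\le r_l^d\le r_u^d\le N$. A schedule is a map $f:\{n_1,\dots,n_N\}\times\{1,\dots,D\}\to\{\mathrm{ON},\mathrm{OFF}\}$ (not cyclic). A work period (resp. off period) of a worker is an inclusion-wise maximal set of consecutive days on which the worker is ON (resp. OFF). A schedule is feasible if on every day $d$ the number of workers that are ON lies in $[r_l^d,r_u^d]$, every work period has length between $l_w$ and $u_w$, every off period has length between $l_o$ and $u_o$, every worker is ON on at most $U_w$ days and OFF on at most $U_o$ days. The decision problem asks whether a feasible schedule exists. The LDODOSP is the DODOSP restricted to instances with $U_w=U_o=D$. *)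

theory Defs
  imports Main
begin

text \<open>Workers n_1..n_N are indexed by 0..N-1, days by 1..D.
  A schedule is f :: nat => nat => bool, f i d = True meaning worker i is ON on day d.
  Values of f outside workers 0..N-1 and days 1..D are irrelevant.\<close>

definition consecutive :: "nat set \<Rightarrow> bool" where
  "consecutive S \<longleftrightarrow> (\<exists>a b. a \<le> b \<and> S = {a..b})"

definition period :: "nat \<Rightarrow> (nat \<Rightarrow> nat \<Rightarrow> bool) \<Rightarrow> nat \<Rightarrow> bool \<Rightarrow> nat set \<Rightarrow> bool" where
  "period D f i s S \<longleftrightarrow>
     consecutive S \<and> S \<subseteq> {1..D} \<and> (\<forall>d\<in>S. f i d = s) \<and>
     (\<forall>T. consecutive T \<and> T \<subseteq> {1..D} \<and> (\<forall>d\<in>T. f i d = s) \<and> S \<subseteq> T \<longrightarrow> T = S)"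

abbreviation work_period where "work_period D f i S \<equiv> period D f i True S"
abbreviation off_period where "off_period D f i S \<equiv> period D f i False S"

definition valid_instance ::
  "nat \<Rightarrow> nat \<Rightarrow> nat \<Rightarrow> nat \<Rightarrow> nat \<Rightarrow> nat \<Rightarrow> nat \<Rightarrow> nat \<Rightarrow> (nat \<Rightarrow> nat) \<Rightarrow> (nat \<Rightarrow> nat) \<Rightarrow> bool" where
  "valid_instance D N lw uw lo uo Uw Uo rl ru \<longleftrightarrow>
     D \<ge> 1 \<and> N \<ge> 1 \<and> (\<forall>d\<in>{1..D}. rl d \<le> ru d \<and> ru d \<le> N)"

definition feasible_schedule ::
  "nat \<Rightarrow> nat \<Rightarrow> nat \<Rightarrow> nat \<Rightarrow> nat \<Rightarrow> nat \<Rightarrow> nat \<Rightarrow> nat \<Rightarrow> (nat \<Rightarrow> nat) \<Rightarrow> (nat \<Rightarrow> nat)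
     \<Rightarrow> (nat \<Rightarrow> nat \<Rightarrow> bool) \<Rightarrow> bool" where
  "feasible_schedule D N lw uw lo uo Uw Uo rl ru f \<longleftrightarrow>
     (\<forall>d\<in>{1..D}. rl d \<le> card {i. i < N \<and> f i d} \<and> card {i. i < N \<and> f i d} \<le> ru d) \<and>
     (\<forall>i<N. \<forall>S. work_period D f i S \<longrightarrow> lw \<le> card S \<and> card S \<le> uw) \<and>
     (\<forall>i<N. \<forall>S. off_period D f i S \<longrightarrow> lo \<le> card S \<and> card S \<le> uo) \<and>
     (\<forall>i<N. card {d\<in>{1..D}. f i d} \<le> Uw \<and> card {d\<in>{1..D}. \<not> f i d} \<le> Uo)"

definition DODOSP_yes ::
  "nat \<Rightarrow> nat \<Rightarrow> nat \<Rightarrow> nat \<Rightarrow> nat \<Rightarrow> nat \<Rightarrow> nat \<Rightarrow> nat \<Rightarrow> (nat \<Rightarrow> nat) \<Rightarrow> (nat \<Rightarrow> nat) \<Rightarrow> bool" where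
  "DODOSP_yes D N lw uw lo uo Uw Uo rl ru \<longleftrightarrow>
     (\<exists>f. feasible_schedule D N lw uw lo uo Uw Uo rl ru f)"

text \<open>Registers indexed by nat, holding integers. Unit cost per instruction.
  Arithmetic is restricted to addition and subtraction (no multiplication/division),
  so that unit cost is a reasonable measure; indirect addressing is available.\<close>

datatype instr =
    LoadC nat int
  | Add nat nat nat
  | Sub nat nat nat
  | LoadI nat nat
  | StoreI nat nat
  | JmpLeZ nat nat
  | Halt

type_synonym config = "nat \<times> (nat \<Rightarrow> int)"

fun exec :: "instr \<Rightarrow> config \<Rightarrow> config" where
  "exec (LoadC r v) (pc, m) = (pc + 1, m(r := v))"
| "exec (Add r a b) (pc, m) = (pc + 1, m(r := m a + m b))"
| "exec (Sub r a b) (pc, m) = (pc + 1, m(r := m a - m b))"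
| "exec (LoadI r a) (pc, m) = (pc + 1, m(r := m (nat (m a))))"
| "exec (StoreI a r) (pc, m) = (pc + 1, m(nat (m a) := m r))"
| "exec (JmpLeZ r t) (pc, m) = (if m r \<le> 0 then (t, m) else (pc + 1, m))"
| "exec Halt (pc, m) = (pc, m)"

definition halted :: "instr list \<Rightarrow> config \<Rightarrow> bool" where
  "halted prog cfg \<longleftrightarrow> fst cfg \<ge> length prog \<or> prog ! fst cfg = Halt"

definition step :: "instr list \<Rightarrow> config \<Rightarrow> config" where
  "step prog cfg = (if halted prog cfg then cfg else exec (prog ! fst cfg) cfg)"

definition run :: "instr list \<Rightarrow> nat \<Rightarrow> config \<Rightarrow> config" where
  "run prog k cfg = (step prog ^^ k) cfg"

text \<open>Input encoding: mem[1] = D, mem[2] = N, mem[3..8] = l_w,u_w,l_o,u_o,U_w,U_o,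
  mem[2d+7] = r_l^d and mem[2d+8] = r_u^d for d = 1..D, all other registers 0.
  The output is register 0: 1 for a yes-instance, 0 for a no-instance.\<close>

definition input_mem ::
  "nat \<Rightarrow> nat \<Rightarrow> nat \<Rightarrow> nat \<Rightarrow> nat \<Rightarrow> nat \<Rightarrow> nat \<Rightarrow> nat \<Rightarrow> (nat \<Rightarrow> nat) \<Rightarrow> (nat \<Rightarrow> nat)
     \<Rightarrow> nat \<Rightarrow> int" where
  "input_mem D N lw uw lo uo Uw Uo rl ru j =
     (if j = 1 then int D else if j = 2 then int N
      else if j = 3 then int lw else if j = 4 then int uw
      else if j = 5 then int lo else if j = 6 then int uo
      else if j = 7 then int Uw else if j = 8 then int Uo
      else if 9 \<le> j \<and> j \<le> 2 * D + 8 then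
        (if odd j then int (rl ((j - 7) div 2)) else int (ru ((j - 7) div 2)))
      else 0)"

end

theory Submission
  imports Defs
begin

text \<open>Workers are interchangeable, so only the numbers a d and b d of ON and OFF starts up to day d
  matter: since periods may be matched first-in first-out, all length bounds and staffing bounds
  are difference constraints between these 2D + 4 unknowns. A schedule yields a solution by adding up
  the counts of its workers. Conversely, x \<mapsto> \<lfloor>(x + i) / N\<rfloor> maps an integral solution for N workers
  to one for the single worker i. The 8D + 8 difference constraints are solved
  by Bellman-Ford in 2D + 4 rounds; one further round detects whether a constraint is violated.\<close>

section \<open>Schedules and difference constraints\<close>

text \<open>A schedule has N * D entries, but the time bound does not mention N. So no schedule is
  ever written down: only the aggregated counts are searched, and dealing them out to the workers is
  a pure existence argument. The rounding is compatible with the length constraints because each of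
  these compares two counts with constant 0 or N: rounding is monotone and turns a shift by N into a
  shift by 1, which yields the constraints of one worker. The staffing constraints have other
  constants and do not survive for a single worker; they return on summing over i, by Hermite's
  identity. Aggregated counts do not show how the ON days are shared between the workers, so this
  route rests on the restriction \<open>Uw = Uo = D\<close>. Quadratic time is then O(D) rounds over
  O(D) edges. As the machine cannot multiply, cell addresses themselves serve as vertices and are
  advanced by addition.\<close>

text \<open>The constraints on the cumulative numbers a d, b d of ON and OFF starts up to day d which say
  that every work period has length between l and u. The schedule is extended to days 0 and D + 1
  by flipping the state of days 1 and D, so that every period begins and ends inside; off periods
  are covered by exchanging the roles of a and b.\<close>

definition half :: "nat \<Rightarrow> nat \<Rightarrow> nat \<Rightarrow> (nat \<Rightarrow> int) \<Rightarrow> (nat \<Rightarrow> int) \<Rightarrow> bool" where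
  "half D l u a b \<longleftrightarrow> a 0 = b 1 \<and> b (D + 1) = a D \<and>
    (\<forall>d\<in>{1..D}. b (min (d - 1 + max l 1) (D + 1)) \<le> a (d - 1) \<and>
                a d \<le> b (min (d + u) (D + 1)) \<and> a (d - 1) \<le> a d)"

definition count_system where
  "count_system D N lw uw lo uo rl ru a b \<longleftrightarrow>
     half D lw uw a b \<and> half D lo uo (\<lambda>d. b d + int N) a \<and>
     (\<forall>d\<in>{1..D}. a d \<le> b d + int (ru d) \<and> b d \<le> a d - int (rl d))"

section \<open>Periods as maximal intervals\<close>

lemma periodE:
  assumes "period D f i s S"
  obtains x y where "S = {x..y}" "1 \<le> x" "x \<le> y" "y \<le> D" "\<And>d. x \<le> d \<Longrightarrow> d \<le> y \<Longrightarrow> f i d = s"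
    "x = 1 \<or> f i (x - 1) \<noteq> s" "y = D \<or> f i (y + 1) \<noteq> s"
proof -
  from assms have S: "consecutive S" "S \<subseteq> {1..D}" "\<forall>d\<in>S. f i d = s"
    and mx: "\<And>T. consecutive T \<Longrightarrow> T \<subseteq> {1..D} \<Longrightarrow> \<forall>d\<in>T. f i d = s \<Longrightarrow> S \<subseteq> T \<Longrightarrow> T = S"
    unfolding period_def by blast+
  then obtain x y where xy: "x \<le> y" "S = {x..y}" "S \<subseteq> {1..D}" "\<forall>d\<in>S. f i d = s"
    unfolding consecutive_def by blast
  have b: "1 \<le> x" "y \<le> D" using xy by auto
  have "x = 1 \<or> f i (x - 1) \<noteq> s"
  proof (rule ccontr)
    assume n: "\<not> ?thesis"
    have "\<forall>d\<in>{x - 1..y}. f i d = s"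
    proof
      fix d assume "d \<in> {x - 1..y}"
      then have "d = x - 1 \<or> d \<in> S" using xy by auto
      then show "f i d = s" using n xy by auto
    qed
    moreover have "{x - 1..y} \<subseteq> {1..D}" using n b by auto
    moreover have "consecutive {x - 1..y}"
      using xy(1) unfolding consecutive_def by (metis diff_le_self le_trans)
    moreover have "S \<subseteq> {x - 1..y}" using xy(2) by auto
    ultimately have "{x - 1..y} = {x..y}" using mx[of "{x - 1..y}"] xy(2) by blast
    then show False using b(1) xy(1) by (simp add: Icc_eq_Icc)
  qed
  moreover have "y = D \<or> f i (y + 1) \<noteq> s"
  proof (rule ccontr)
    assume n: "\<not> ?thesis"
    have "\<forall>d\<in>{x..y + 1}. f i d = s"
    proof
      fix d assume "d \<in> {x..y + 1}"
      then have "d = y + 1 \<or> d \<in> S" using xy by auto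
      then show "f i d = s" using n xy by auto
    qed
    moreover have "{x..y + 1} \<subseteq> {1..D}" using n b by auto
    moreover have "consecutive {x..y + 1}"
      using xy(1) unfolding consecutive_def by (metis le_add1 le_trans)
    moreover have "S \<subseteq> {x..y + 1}" using xy(2) by auto
    ultimately have "{x..y + 1} = {x..y}" using mx[of "{x..y + 1}"] xy(2) by blast
    then show False using xy(1) by (simp add: Icc_eq_Icc)
  qed
  ultimately show thesis using that[of x y] xy b by (meson atLeastAtMost_iff)
qed

lemma periodI:
  assumes "1 \<le> x" "x \<le> y" "y \<le> D" "\<And>d. x \<le> d \<Longrightarrow> d \<le> y \<Longrightarrow> f i d = s"
    "x = 1 \<or> f i (x - 1) \<noteq> s" "y = D \<or> f i (y + 1) \<noteq> s"
  shows "period D f i s {x..y}"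
  unfolding period_def
proof (intro conjI allI impI)
  show "consecutive {x..y}" using assms unfolding consecutive_def by blast
  show "{x..y} \<subseteq> {1..D}" "\<forall>d\<in>{x..y}. f i d = s" using assms by auto
  fix T assume T: "consecutive T \<and> T \<subseteq> {1..D} \<and> (\<forall>d\<in>T. f i d = s) \<and> {x..y} \<subseteq> T"
  then obtain p q where pq: "p \<le> q" "T = {p..q}" unfolding consecutive_def by blast
  have le: "1 \<le> p" "p \<le> x" "y \<le> q" "q \<le> D" using T pq assms by auto
  have "\<not> p < x"
  proof
    assume "p < x"
    then have "x - 1 \<in> T" "x \<noteq> 1" using pq le assms by auto
    then show False using T assms(5) by auto
  qed
  moreover have "\<not> y < q"
  proof
    assume "y < q"
    then have "y + 1 \<in> T" "y \<noteq> D" using pq le assms by auto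
    then show False using T assms(6) by auto
  qed
  ultimately show "T = {x..y}" using pq le by auto
qed

lemma period_extends:
  assumes "1 \<le> x" "x \<le> y" "y \<le> D" "\<And>d. x \<le> d \<Longrightarrow> d \<le> y \<Longrightarrow> f i d = s"
  obtains S where "period D f i s S" "{x..y} \<subseteq> S" "finite S"
proof -
  let ?A = "{T. consecutive T \<and> T \<subseteq> {1..D} \<and> (\<forall>d\<in>T. f i d = s)}"
  have "finite ?A" by (rule finite_subset[of _ "Pow {1..D}"]) auto
  moreover have "{x..y} \<in> ?A" using assms unfolding consecutive_def by auto
  ultimately obtain S where S: "S \<in> ?A" "{x..y} \<subseteq> S" "\<forall>T\<in>?A. S \<subseteq> T \<longrightarrow> S = T"
    using finite_has_maximal2[of ?A "{x..y}"] by auto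
  then have "period D f i s S" unfolding period_def by auto
  moreover have "finite S" using S(1) finite_subset by blast
  ultimately show thesis using that S by blast
qed

section \<open>From counts to period lengths\<close>

lemma mono_on_upto:
  fixes a :: "nat \<Rightarrow> int"
  assumes "\<And>d. d < n \<Longrightarrow> a d \<le> a (Suc d)" "x \<le> y" "y \<le> n"
  shows "a x \<le> a y"
  using assms(2,3)
proof (induction y rule: dec_induct)
  case (step k)
  then show ?case using assms(1)[of k] by linarith
qed simp

lemma half_mono:
  assumes "half D l u a b" "half D l' u' (\<lambda>d. b d + c) a" "\<forall>d\<in>{1..D}. b d \<le> a d \<and> a d \<le> b d + c"
    "1 \<le> D" "x \<le> y" "y \<le> D + 1"
  shows "a x \<le> a y" "b x \<le> b y"
proof -
  have "a d \<le> a (Suc d) \<and> b d \<le> b (Suc d)" if "d < D + 1" for d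
  proof (cases "d = D")
    case True
    \<comment> \<open>The step onto the virtual day D + 1 comes from the boundary equations
      \<open>b (D + 1) = a D\<close> and \<open>a (D + 1) = b D + c\<close>.\<close>
    then show ?thesis using assms(1-4) by (auto simp: half_def)
  next
    case False
    then have "Suc d \<in> {1..D}" using that by auto
    then show ?thesis using assms(1,2) unfolding half_def by fastforce
  qed
  then show "a x \<le> a y" "b x \<le> b y" using mono_on_upto[of "D + 1"] assms(5,6) by blast+
qed

text \<open>Whoever starts an OFF period on the next day is ON today. The use of
  \<open>max l 1\<close> in \<open>half\<close> yields this even for l = 0.\<close>

lemma half_next:
  assumes "half D l u a b" "half D l' u' (\<lambda>d. b d + c) a" "\<forall>d\<in>{1..D}. b d \<le> a d \<and> a d \<le> b d + c"
    "1 \<le> D" "d \<le> D"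
  shows "b (Suc d) \<le> a d"
proof (cases "d = D")
  case True
  then show ?thesis using assms(1) by (auto simp: half_def)
next
  case False
  then have "Suc d \<in> {1..D}" using assms(5) by auto
  then have "b (min (d + max l 1) (D + 1)) \<le> a d" using assms(1) unfolding half_def by fastforce
  moreover have "b (Suc d) \<le> b (min (d + max l 1) (D + 1))"
    using half_mono(2)[OF assms(1-4), of "Suc d" "min (d + max l 1) (D + 1)"] assms(5) by auto
  ultimately show ?thesis by simp
qed

lemma half_shift: "half D l u a b \<Longrightarrow> half D l u (\<lambda>d. a d + c) (\<lambda>d. b d + c)"
  by (auto simp: half_def)

text \<open>With shift 1 the counts belong to a single worker, whose starts and ends alternate.
  Throughout a period \<open>{x..y}\<close> the value of \<open>b\<close> is
  \<open>a (x - 1)\<close> and that of \<open>a\<close> is one more, and \<open>b\<close> catches up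
  on day y + 1. The two length constraints at day x then bound y + 1 - x. Leaving \<open>s\<close>
  open makes the lemma serve off periods too, with \<open>b + 1\<close> and \<open>a\<close> as
  counts.\<close>

lemma half_period_length:
  assumes h: "half D l u a b" "half D l' u' (\<lambda>d. b d + 1) a"
    and ab: "\<forall>d\<in>{1..D}. b d \<le> a d \<and> a d \<le> b d + 1" and D: "1 \<le> D"
    and f: "\<forall>d\<in>{1..D}. (f i d = s) \<longleftrightarrow> b d < a d" and S: "period D f i s S"
  shows "l \<le> card S \<and> card S \<le> u"
proof -
  note mono = half_mono[OF h ab D] and nxt = half_next[OF h ab D]
  have h2: "half D l u (\<lambda>d. a d + 1) (\<lambda>d. b d + 1)" using half_shift[OF h(1)] .
  have nxt': "a (Suc d) \<le> b d + 1" if "d \<le> D" for d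
    using half_next[OF h(2) h2 _ D that] ab by auto
  obtain x y where xy: "S = {x..y}" "1 \<le> x" "x \<le> y" "y \<le> D"
    "\<And>d. x \<le> d \<Longrightarrow> d \<le> y \<Longrightarrow> f i d = s" "x = 1 \<or> f i (x - 1) \<noteq> s" "y = D \<or> f i (y + 1) \<noteq> s"
    by (rule periodE[OF S]) blast
  have f': "f i d \<noteq> s \<Longrightarrow> a d \<le> b d" if "1 \<le> d" "d \<le> D" for d
    using f that by fastforce
  have on: "a d = b d + 1" if "x \<le> d" "d \<le> y" for d
  proof -
    have "d \<in> {1..D}" "f i d = s" using xy that by auto
    then show ?thesis using f ab by fastforce
  qed
  have ax: "a (x - 1) = b x"
  proof (cases "x = 1")
    case True
    then show ?thesis using h(1) by (auto simp: half_def)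
  next
    case False
    then have "a (x - 1) \<le> b (x - 1)" using xy(2-4,6) f'[of "x - 1"] by auto
    moreover have "b (x - 1) \<le> b x" using mono(2)[of "x - 1" x] xy(3,4) by auto
    moreover have "b x \<le> a (x - 1)" using nxt[of "x - 1"] xy(2-4) by auto
    ultimately show ?thesis by simp
  qed
  have by1: "b (y + 1) = a y"
  proof (cases "y = D")
    case True
    then show ?thesis using h(1) by (auto simp: half_def)
  next
    case False
    then have "a (y + 1) \<le> b (y + 1)" using xy(4,7) f'[of "y + 1"] by auto
    moreover have "a y \<le> a (y + 1)" using mono(1)[of y "y + 1"] xy(4) by auto
    moreover have "b (y + 1) \<le> a y" using nxt[of y] xy(4) by auto
    ultimately show ?thesis by simp
  qed
  have const: "a y = a x"
    using xy(3)
  proof (rule dec_induct[where P = "\<lambda>k. k \<le> y \<longrightarrow> a k = a x", THEN mp])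
    fix k assume k: "x \<le> k" "k < y" and IH: "k \<le> y \<longrightarrow> a k = a x"
    have "a (Suc k) \<le> a k" using nxt'[of k] on[of k] k xy(4) by auto
    moreover have "a k \<le> a (Suc k)" using mono(1)[of k "Suc k"] k xy(4) by auto
    ultimately show "Suc k \<le> y \<longrightarrow> a (Suc k) = a x" using IH k by auto
  qed auto
  \<comment> \<open>Otherwise the lower constraint at day x reaches day y + 1, where
    \<open>b\<close> already equals \<open>a (x - 1) + 1\<close>.\<close>
  have "max l 1 \<le> y + 1 - x"
  proof (rule ccontr)
    assume n: "\<not> ?thesis"
    let ?M = "min (x - 1 + max l 1) (D + 1)"
    have "b (y + 1) \<le> b ?M" using mono(2)[of "y + 1" ?M] n xy(2-4) by auto
    moreover have "b ?M \<le> a (x - 1)" using h(1) xy(2-4) by (auto simp: half_def)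
    ultimately show False using ax by1 const on[of x] xy(3) by linarith
  qed
  moreover have "y + 1 - x \<le> u"
  proof (rule ccontr)
    assume n: "\<not> ?thesis"
    have "a x \<le> b (min (x + u) (D + 1))" using h(1) xy(2-4) by (auto simp: half_def)
    moreover have "b (min (x + u) (D + 1)) \<le> b y" using mono(2)[of "min (x + u) (D + 1)" y] n xy(4) by auto
    ultimately show False using const on[of y] xy(3) by linarith
  qed
  ultimately show ?thesis using xy(1) by simp
qed

text \<open>Difference form of Hermite's identity: the floors of (y + i) / n for i < n sum to y.
  Raising k by one shifts the summation index by one, so the increment telescopes to one difference
  of quotients, which is 1.\<close>

lemma sum_div_shift:
  fixes x :: int and n k :: nat
  assumes "0 < n"
  shows "(\<Sum>i<n. (x + int k + int i) div int n - (x + int i) div int n) = int k"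
proof (induction k)
  case (Suc k)
  have "(\<Sum>i<n. (x + int (Suc k) + int i) div int n - (x + int k + int i) div int n) =
    (\<Sum>i<n. (x + int k + int (Suc i)) div int n - (x + int k + int i) div int n)"
    by (intro sum.cong) (auto simp: algebra_simps)
  also have "\<dots> = (x + int k + int n) div int n - (x + int k + int 0) div int n"
    by (rule sum_lessThan_telescope)
  also have "\<dots> = 1" using assms div_add_self2[of "int n" "x + int k"] by simp
  finally show ?case using Suc by (simp add: sum_subtractf)
qed simp

text \<open>Matching starts and ends first-in first-out makes the workers take their turns cyclically:
  worker i is ON on day d iff some j in {b d..<a d} is congruent to - i - 1 modulo N.\<close>

lemma schedule_of_counts:
  assumes sys: "count_system D N lw uw lo uo rl ru a b"
    and D: "1 \<le> D" and N: "1 \<le> N" and ru: "\<forall>d\<in>{1..D}. ru d \<le> N"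
  shows "feasible_schedule D N lw uw lo uo D D rl ru (\<lambda>i d. (b d + int i) div int N < (a d + int i) div int N)"
    (is "feasible_schedule _ _ _ _ _ _ _ _ _ _ ?f")
proof -
  define \<phi> where "\<phi> i x = (x + int i) div int N" for i x
  have mono: "\<phi> i x \<le> \<phi> i y" if "x \<le> y" for i x y
    unfolding \<phi>_def using that N by (intro zdiv_mono1) auto
  have shift: "\<phi> i (x + int N) = \<phi> i x + 1" for i x
  proof -
    have "x + int N + int i = (x + int i) + int N" by simp
    then show ?thesis unfolding \<phi>_def using N by (simp only: div_add_self2)
  qed
  have ab: "0 \<le> a d - b d" "int (rl d) \<le> a d - b d" "a d - b d \<le> int (ru d)" "a d \<le> b d + int N" if "d \<in> {1..D}" for d
    using sys ru that unfolding count_system_def by fastforce+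
  \<comment> \<open>Comparisons with constant 0 pass to a single worker by monotonicity of
    \<open>\<phi> i\<close>; in \<open>h2\<close> the constant N becomes 1 by
    \<open>shift\<close>.\<close>
  have h1: "half D lw uw (\<lambda>d. \<phi> i (a d)) (\<lambda>d. \<phi> i (b d))" for i
    using sys mono unfolding count_system_def half_def by auto
  have h2: "half D lo uo (\<lambda>d. \<phi> i (b d) + 1) (\<lambda>d. \<phi> i (a d))" for i
  proof -
    have "half D lo uo (\<lambda>d. \<phi> i (b d + int N)) (\<lambda>d. \<phi> i (a d))"
      using sys mono unfolding count_system_def half_def by auto
    then show ?thesis by (simp add: shift)
  qed
  have \<phi>ab: "\<phi> i (b d) \<le> \<phi> i (a d)" "\<phi> i (a d) \<le> \<phi> i (b d) + 1" if "d \<in> {1..D}" for i d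
    using mono[of "b d" "a d" i] mono[of "a d" "b d + int N" i] ab[OF that] shift by auto
  have card: "int (card {i. i < N \<and> ?f i d}) = a d - b d" if d: "d \<in> {1..D}" for d
  proof -
    have "int (card {i. i < N \<and> ?f i d}) = (\<Sum>i\<in>{i. i < N \<and> ?f i d}. 1)" by simp
    also have "\<dots> = (\<Sum>i<N. if ?f i d then 1 else 0)"
      by (subst sum.inter_filter[symmetric]) (auto intro!: sum.cong)
    also have "\<dots> = (\<Sum>i<N. \<phi> i (a d) - \<phi> i (b d))"
    proof (intro sum.cong refl)
      fix i
      show "(if ?f i d then 1 else 0) = \<phi> i (a d) - \<phi> i (b d)"
        using \<phi>ab[OF d, of i] unfolding \<phi>_def by auto
    qed
    also have "\<dots> = a d - b d"
      using sum_div_shift[of N "b d" "nat (a d - b d)"] N ab[OF d] unfolding \<phi>_def by simp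
    finally show ?thesis .
  qed
  have on: "lw \<le> card S \<and> card S \<le> uw" if "work_period D ?f i S" for i S
    using half_period_length[OF h1[of i] h2[of i] _ D _ that] \<phi>ab by (auto simp: \<phi>_def)
  \<comment> \<open>For off periods the counts are \<open>b + 1\<close> and \<open>a\<close>, so the
    companion constraints of the work periods have to be raised by 1 as well.\<close>
  have h3: "half D lw uw (\<lambda>d. \<phi> i (a d) + 1) (\<lambda>d. \<phi> i (b d) + 1)" for i using half_shift[OF h1] .
  have off: "lo \<le> card S \<and> card S \<le> uo" if "off_period D ?f i S" for i S
  proof (rule half_period_length[OF h2[of i] h3[of i] _ D _ that])
    show "\<forall>d\<in>{1..D}. \<phi> i (a d) \<le> \<phi> i (b d) + 1 \<and> \<phi> i (b d) + 1 \<le> \<phi> i (a d) + 1"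
      using \<phi>ab by auto
    show "\<forall>d\<in>{1..D}. ((b d + int i) div int N < (a d + int i) div int N) = False \<longleftrightarrow> \<phi> i (a d) < \<phi> i (b d) + 1"
      by (auto simp: \<phi>_def)
  qed
  \<comment> \<open>Here the restriction enters: the totals of the single workers are bounded only
    by the number D of days.\<close>
  have le: "card {d\<in>{1..D}. P d} \<le> D" for P
  proof -
    have "card {d\<in>{1..D}. P d} \<le> card {1..D}" by (rule card_mono) auto
    then show ?thesis by simp
  qed
  have cnt: "rl d \<le> card {i. i < N \<and> ?f i d} \<and> card {i. i < N \<and> ?f i d} \<le> ru d" if "d \<in> {1..D}" for d
    using card[OF that] ab[OF that] by linarith
  show ?thesis
    unfolding feasible_schedule_def by (intro conjI ballI allI impI) ((rule le | blast dest: cnt on off)+)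
qed

section \<open>From a schedule to its counts\<close>

lemma half_of_periods:
  fixes a b :: "nat \<Rightarrow> int"
  assumes ab: "\<And>d. a d - b d = of_bool (h d)"
    and ta: "\<And>d. h d \<Longrightarrow> a (Suc d) = a d" and tb: "\<And>d. \<not> h d \<Longrightarrow> b (Suc d) = b d"
    and h0: "h 0 \<longleftrightarrow> \<not> h 1" and hD: "h (D + 1) \<longleftrightarrow> \<not> h D"
    and hf: "\<And>d. d \<in> {1..D} \<Longrightarrow> h d \<longleftrightarrow> f i d = s"
    and per: "\<And>S. period D f i s S \<Longrightarrow> l \<le> card S \<and> card S \<le> u"
  shows "half D l u a b"
proof -
  have step: "a d \<le> a (Suc d)" "b d \<le> b (Suc d)" "a (Suc d) \<le> b d + 1" "b (Suc d) \<le> a d" for d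
    using ta[of d] tb[of d] ab[of d] ab[of "Suc d"] by (cases "h d"; cases "h (Suc d)"; simp)+
  have ma: "a x \<le> a y" and mb: "b x \<le> b y" if "x \<le> y" for x y
    using mono_on_upto[of y a x y] mono_on_upto[of y b x y] step that by auto
  have ba: "b d \<le> a d" "a d \<le> b d + 1" for d using ab[of d] by (cases "h d"; simp)+
  have on: "h d" if "b d < a d" for d using ab[of d] that by (cases "h d") auto
  have e0: "a 0 = b 1" using h0 ab[of 0] ab[of 1] ta[of 0] tb[of 0] by (cases "h 0") auto
  have eD: "b (D + 1) = a D" using hD ab[of D] ab[of "D + 1"] ta[of D] tb[of D] by (cases "h D") auto
  \<comment> \<open>If the constraint fails with c = \<open>a (d - 1)\<close>, consider the period
    whose start first lifts \<open>a\<close> above c and whose end first lifts \<open>b\<close>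
    above c. It begins on day d or later and \<open>b\<close> passes c by day d - 1 +
    \<open>max l 1\<close>, so its length is at most \<open>max l 1 - 1\<close>: too short, or empty
    if l = 0.\<close>
  have lower: "b (min (d - 1 + max l 1) (D + 1)) \<le> a (d - 1)" if d: "d \<in> {1..D}" for d
  proof (rule ccontr)
    define M where "M = min (d - 1 + max l 1) (D + 1)"
    define c where "c = a (d - 1)"
    assume "\<not> ?thesis"
    then have bM: "c < b M" by (simp add: M_def c_def)
    define e where "e = (LEAST e. c < b e)"
    have e: "c < b e" and eM: "e \<le> M" unfolding e_def using bM by (auto intro: LeastI Least_le)
    have "d - 1 < e" using mb[of e "d - 1"] ba[of "d - 1"] e unfolding c_def by (cases "d - 1 < e") auto
    then obtain y where y: "e = Suc y" by (cases e) auto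
    have byc: "b y \<le> c" using not_less_Least[of y "\<lambda>e. c < b e"] y unfolding e_def by auto
    have hy: "h y" and nhy: "\<not> h (Suc y)"
      using byc e y tb[of y] ab[of y] ab[of "Suc y"] ta[of y] by (cases "h y"; cases "h (Suc y)"; simp)+
    have ay: "c < a y" using step(4)[of y] e y by simp
    define x where "x = (LEAST x. c < a x)"
    have x: "c < a x" and xy: "x \<le> y" unfolding x_def using ay by (auto intro: LeastI Least_le)
    have dx: "d - 1 < x" using ma[of x "d - 1"] x unfolding c_def by (cases "d - 1 < x") auto
    then obtain x' where x': "x = Suc x'" by (cases x) auto
    have "a x' \<le> c" using not_less_Least[of x' "\<lambda>x. c < a x"] x' unfolding x_def by auto
    then have nhx: "\<not> h x'" using x x' ta[of x'] by auto
    have yD: "y \<le> D" using eM y unfolding M_def by auto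
    have "period D f i s {x..y}"
    proof (rule periodI)
      show "1 \<le> x" "x \<le> y" "y \<le> D" using x' xy yD by auto
      show "f i k = s" if "x \<le> k" "k \<le> y" for k
        using on[of k] ma[OF that(1)] mb[OF that(2)] byc x hf[of k] that x' yD by auto
      show "x = 1 \<or> f i (x - 1) \<noteq> s" using nhx x' xy yD hf[of x'] by auto
      show "y = D \<or> f i (y + 1) \<noteq> s" using nhy yD hf[of "y + 1"] by auto
    qed
    then have "l \<le> y + 1 - x" using per by fastforce
    then show False using eM y dx xy unfolding M_def by auto
  qed
  \<comment> \<open>Beyond the horizon \<open>b (D + 1) = a D\<close> says that all periods have
    ended. Before it, a violation gives b < a on each of the u + 1 days from d to d + u, hence a
    period that is too long.\<close>
  have upper: "a d \<le> b (min (d + u) (D + 1))" if d: "d \<in> {1..D}" for d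
  proof (cases "d + u \<le> D")
    case False
    then have "min (d + u) (D + 1) = D + 1" by simp
    then show ?thesis using eD ma[of d D] d by auto
  next
    case True
    show ?thesis
    proof (rule ccontr)
      assume "\<not> ?thesis"
      then have n: "b (d + u) < a d" using True by simp
      have hk: "f i k = s" if "d \<le> k" "k \<le> d + u" for k
        using on[of k] ma[OF that(1)] mb[OF that(2)] n hf[of k] that True d by auto
      obtain S where "period D f i s S" "{d..d + u} \<subseteq> S" "finite S"
        using period_extends[of d "d + u" D f i s] hk d True by auto
      then have "card {d..d + u} \<le> u" using per card_mono le_trans by blast
      then show False by simp
    qed
  qed
  have "a (d - 1) \<le> a d" for d using ma by simp
  then show ?thesis unfolding half_def using e0 eD lower upper by blast
qed

lemma counts_of_worker:
  fixes f :: "nat \<Rightarrow> nat \<Rightarrow> bool"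
  assumes "1 \<le> D"
    and on: "\<And>S. work_period D f i S \<Longrightarrow> lw \<le> card S \<and> card S \<le> uw"
    and off: "\<And>S. off_period D f i S \<Longrightarrow> lo \<le> card S \<and> card S \<le> uo"
  obtains a b :: "nat \<Rightarrow> int" where "half D lw uw a b" "half D lo uo (\<lambda>d. b d + 1) a"
    "\<And>d. d \<in> {1..D} \<Longrightarrow> a d - b d = of_bool (f i d)"
proof -
  define h where "h d = (if d = 0 then \<not> f i 1 else if d = D + 1 then \<not> f i D else f i d)" for d
  \<comment> \<open>A worker who is ON on the virtual day 0 counts as started there; this makes
    \<open>a - b\<close> the indicator of being ON.\<close>
  define a where "a d = of_bool (h 0) + (\<Sum>e<d. of_bool (h (Suc e) \<and> \<not> h e) :: int)" for d
  define b where "b d = (\<Sum>e<d. of_bool (\<not> h (Suc e) \<and> h e) :: int)" for d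
  have ab: "a d - b d = of_bool (h d)" for d
    by (induction d) (auto simp: a_def b_def)
  have ta: "a (Suc d) = a d" if "h d" for d using that by (simp add: a_def)
  have tb: "b (Suc d) = b d" if "\<not> h d" for d using that by (simp add: b_def)
  have h0: "h 0 \<longleftrightarrow> \<not> h 1" "h (D + 1) \<longleftrightarrow> \<not> h D" using assms(1) by (auto simp: h_def)
  have hf: "h d = f i d" if "d \<in> {1..D}" for d using that by (auto simp: h_def)
  have "half D lw uw a b"
    using half_of_periods[of a b h, OF ab ta tb h0 _ on] hf by auto
  moreover have "half D lo uo (\<lambda>d. b d + 1) a"
  proof (rule half_of_periods[of "\<lambda>d. b d + 1" a "\<lambda>d. \<not> h d", OF _ _ _ _ _ _ off])
    show "b d + 1 - a d = of_bool (\<not> h d)" for d using ab[of d] by (cases "h d") auto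
  qed (use ta tb h0 hf in auto)
  moreover have "a d - b d = of_bool (f i d)" if "d \<in> {1..D}" for d using ab hf[OF that] by simp
  ultimately show thesis using that by blast
qed

text \<open>The relations in \<open>half\<close> are homogeneous and linear in the two counts, hence
  closed under addition; applied to off periods, the shifts by 1 of the N workers add up to
  N.\<close>

lemma half_sum:
  assumes "\<And>i. i < n \<Longrightarrow> half D l u (a i) (b i)"
  shows "half D l u (\<lambda>d. \<Sum>i<n. a i d) (\<lambda>d. \<Sum>i<n. b i d)"
  using assms unfolding half_def by (auto intro!: sum_mono sum.cong)

lemma counts_of_schedule:
  assumes f: "feasible_schedule D N lw uw lo uo Uw Uo rl ru f" and D: "1 \<le> D"
  shows "\<exists>a b. count_system D N lw uw lo uo rl ru a b"
proof -
  have "\<forall>i. \<exists>a b :: nat \<Rightarrow> int. i < N \<longrightarrow> half D lw uw a b \<and> half D lo uo (\<lambda>d. b d + 1) a \<and>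
    (\<forall>d\<in>{1..D}. a d - b d = of_bool (f i d))"
  proof
    fix i
    show "\<exists>a b :: nat \<Rightarrow> int. i < N \<longrightarrow> half D lw uw a b \<and> half D lo uo (\<lambda>d. b d + 1) a \<and>
      (\<forall>d\<in>{1..D}. a d - b d = of_bool (f i d))"
    proof (cases "i < N")
      case True
      then have "\<And>S. work_period D f i S \<Longrightarrow> lw \<le> card S \<and> card S \<le> uw"
        "\<And>S. off_period D f i S \<Longrightarrow> lo \<le> card S \<and> card S \<le> uo"
        using f unfolding feasible_schedule_def by blast+
      from counts_of_worker[OF D this] show ?thesis by metis
    qed simp
  qed
  then obtain a b :: "nat \<Rightarrow> nat \<Rightarrow> int" where
    w: "\<And>i. i < N \<Longrightarrow> half D lw uw (a i) (b i)"
      "\<And>i. i < N \<Longrightarrow> half D lo uo (\<lambda>d. b i d + 1) (a i)"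
      "\<And>i d. i < N \<Longrightarrow> d \<in> {1..D} \<Longrightarrow> a i d - b i d = of_bool (f i d)"
    by metis
  let ?a = "\<lambda>d. \<Sum>i<N. a i d" and ?b = "\<lambda>d. \<Sum>i<N. b i d"
  have cnt: "?a d - ?b d = int (card {i. i < N \<and> f i d})" if "d \<in> {1..D}" for d
  proof -
    have "?a d - ?b d = (\<Sum>i<N. of_bool (f i d))"
      using w(3)[OF _ that] by (simp flip: sum_subtractf)
    also have "\<dots> = (\<Sum>i\<in>{i. i < N \<and> f i d}. 1)"
      by (simp add: of_bool_def lessThan_def flip: sum.inter_filter)
    finally show ?thesis by simp
  qed
  have "half D lo uo (\<lambda>d. \<Sum>i<N. b i d + 1) ?a" using half_sum[of N D lo uo "\<lambda>i d. b i d + 1" a] w(2) .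
  then have "half D lo uo (\<lambda>d. ?b d + int N) ?a" by (simp add: sum.distrib)
  moreover have "half D lw uw ?a ?b" using half_sum w(1) .
  moreover have "?a d \<le> ?b d + int (ru d)" "?b d \<le> ?a d - int (rl d)" if "d \<in> {1..D}" for d
  proof -
    have "rl d \<le> card {i. i < N \<and> f i d}" "card {i. i < N \<and> f i d} \<le> ru d"
      using f that unfolding feasible_schedule_def by blast+
    then show "?a d \<le> ?b d + int (ru d)" "?b d \<le> ?a d - int (rl d)" using cnt[OF that] by linarith+
  qed
  ultimately show ?thesis unfolding count_system_def by blast
qed

theorem DODOSP_yes_iff_count_system:
  assumes "valid_instance D N lw uw lo uo D D rl ru"
  shows "DODOSP_yes D N lw uw lo uo D D rl ru \<longleftrightarrow> (\<exists>a b. count_system D N lw uw lo uo rl ru a b)"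
proof
  show "\<exists>a b. count_system D N lw uw lo uo rl ru a b" if "DODOSP_yes D N lw uw lo uo D D rl ru"
    using that assms unfolding DODOSP_yes_def valid_instance_def by (blast intro: counts_of_schedule)
  show "DODOSP_yes D N lw uw lo uo D D rl ru" if "\<exists>a b. count_system D N lw uw lo uo rl ru a b"
    using that assms unfolding DODOSP_yes_def valid_instance_def by (blast intro: schedule_of_counts)
qed

section \<open>Bellman-Ford\<close>

fun sat :: "'v \<times> 'v \<times> int \<Rightarrow> ('v \<Rightarrow> int) \<Rightarrow> bool" where
  "sat (u, v, w) x \<longleftrightarrow> x v \<le> x u + w"

fun relax :: "'v \<times> 'v \<times> int \<Rightarrow> ('v \<Rightarrow> int) \<Rightarrow> ('v \<Rightarrow> int)" where
  "relax (u, v, w) x = x(v := min (x v) (x u + w))"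

lemma relax_sat: "sat e x \<Longrightarrow> relax e x = x"
  by (cases e) (auto simp: fun_eq_iff)

lemma fold_relax_sat: "\<forall>e\<in>set es. sat e x \<Longrightarrow> fold relax es x = x"
  by (induction es) (auto simp: relax_sat)

text \<open>With respect to a solution y all reduced costs are nonnegative, so as in Dijkstra's
  algorithm every round settles one more vertex: a vertex of least x - y outside the settled
  set T never changes again.\<close>

definition settled :: "('v \<times> 'v \<times> int) list \<Rightarrow> 'v set \<Rightarrow> ('v \<Rightarrow> int) \<Rightarrow> 'v set \<Rightarrow> ('v \<Rightarrow> int) \<Rightarrow> bool" where
  "settled es V y T x \<longleftrightarrow> T \<subseteq> V \<and> (\<forall>(u, v, w)\<in>set es. u \<in> T \<longrightarrow> x v \<le> x u + w) \<and>
     (\<forall>t\<in>T. \<forall>v\<in>V - T. x t - y t \<le> x v - y v)"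

lemma settled_round:
  assumes fin: "finite V" and edges: "set es \<subseteq> V \<times> V \<times> UNIV" and y: "\<forall>e\<in>set es. sat e y"
    and st: "settled es V y T x" and ne: "T \<noteq> V"
  shows "\<exists>u\<in>V - T. settled es V y (insert u T) (fold relax es x)"
proof -
  from st ne have TV: "T \<subseteq> V" and "V - T \<noteq> {}"
    by (auto simp: settled_def)
  then obtain u where u: "u \<in> V - T" and umin: "\<And>v. v \<in> V - T \<Longrightarrow> x u - y u \<le> x v - y v"
    using ex_min_if_finite[of "(\<lambda>v. x v - y v) ` (V - T)"] fin
    by (fastforce simp: not_less)
  have out: "x v \<le> x s + w" if "(s, v, w) \<in> set es" "s \<in> T" for s v w
    using st that by (auto simp: settled_def)
  have le: "x t - y t \<le> x u - y u" if "t \<in> insert u T" for t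
    using st that u by (auto simp: settled_def)
  \<comment> \<open>Relaxations see values already updated in the same round, hence an invariant
    over the processed prefix \<open>ps\<close>: values on \<open>insert u T\<close> are frozen,
    elsewhere the excess over \<open>y\<close> stays at least that of \<open>u\<close>, no value
    grows, and processed edges out of \<open>u\<close> hold. The latter persist because
    \<open>z u\<close> is frozen and their heads can only drop.\<close>
  define inv where "inv ps z \<longleftrightarrow> (\<forall>t\<in>insert u T. z t = x t) \<and> (\<forall>v\<in>V - T. x u - y u \<le> z v - y v)
    \<and> (\<forall>v. z v \<le> x v) \<and> (\<forall>(s, v, w)\<in>set ps. s = u \<longrightarrow> z v \<le> z s + w)" for ps z
  have step: "inv (ps @ [(s, v, w)]) (relax (s, v, w) z)"
    if i: "inv ps z" and e: "(s, v, w) \<in> set es" for ps z s v w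
  proof -
    have sv: "s \<in> V" "v \<in> V" using e edges by auto
    have yw: "y v \<le> y s + w" using y e by fastforce
    \<comment> \<open>No edge lowers a frozen head: a source in \<open>T\<close> already satisfies
      its outgoing edges, and any other source has at least the excess of the head while the reduced
      cost of the edge is nonnegative.\<close>
    have a: "z v \<le> z s + w" if v: "v \<in> insert u T"
    proof (cases "s \<in> T")
      case True
      then show ?thesis using out[OF e] i v by (auto simp: inv_def)
    next
      case False
      then have "x u - y u \<le> z s - y s" using i sv by (auto simp: inv_def)
      moreover have "z v = x v" using i v by (auto simp: inv_def)
      ultimately show ?thesis using le[OF v] yw by linarith
    qed
    have b: "x u - y u \<le> z s + w - y v" if v: "v \<in> V - T"
    proof (cases "s \<in> T")
      case True
      then have "x v \<le> z s + w" using out[OF e] i by (auto simp: inv_def)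
      then show ?thesis using umin[OF v] by linarith
    next
      case False
      then have "x u - y u \<le> z s - y s" using i sv by (auto simp: inv_def)
      then show ?thesis using yw by linarith
    qed
    have z': "relax (s, v, w) z t = (if t = v then min (z v) (z s + w) else z t)" for t
      by simp
    show ?thesis
      unfolding inv_def
    proof (intro conjI)
      show "\<forall>t\<in>insert u T. relax (s, v, w) z t = x t"
        using i a unfolding z' by (auto simp: inv_def min_def)
      show "\<forall>t\<in>V - T. x u - y u \<le> relax (s, v, w) z t - y t"
        using i b unfolding z' by (auto simp: inv_def min_def)
      show "\<forall>t. relax (s, v, w) z t \<le> x t"
        using i unfolding z' by (auto simp: inv_def min_def intro: order.trans)
      have "relax (s, v, w) z u = z u"
        using a unfolding z' by auto
      moreover have "z v' \<le> z u + w'" if "(u, v', w') \<in> set ps" for v' w'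
        using i that by (auto simp: inv_def)
      moreover have "relax (s, v, w) z v' \<le> z v'" for v' by simp
      ultimately show "\<forall>(s', v', w')\<in>set (ps @ [(s, v, w)]).
         s' = u \<longrightarrow> relax (s, v, w) z v' \<le> relax (s, v, w) z s' + w'"
        by (fastforce intro: order.trans)
    qed
  qed
  have "inv ps (fold relax ps x)" if "set ps \<subseteq> set es" for ps
    using that
  proof (induction ps rule: rev_induct)
    case Nil
    then show ?case using umin by (auto simp: inv_def)
  next
    case (snoc e ps)
    then show ?case using step[of ps "fold relax ps x" "fst e" "fst (snd e)" "snd (snd e)"] by simp
  qed
  then have i: "inv es (fold relax es x)" by blast
  have "settled es V y (insert u T) (fold relax es x)"
    unfolding settled_def
  proof (intro conjI)
    show "insert u T \<subseteq> V" using u TV by auto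
    let ?z = "fold relax es x"
    show "\<forall>(s, v, w)\<in>set es. s \<in> insert u T \<longrightarrow> ?z v \<le> ?z s + w"
    proof (clarify)
      fix s v w assume e: "(s, v, w) \<in> set es" "s \<in> insert u T"
      show "?z v \<le> ?z s + w"
      proof (cases "s = u")
        case True
        then show ?thesis using i e by (auto simp: inv_def)
      next
        case False
        then have "x v \<le> x s + w" using out e by auto
        moreover have "?z v \<le> x v" "?z s = x s" using i e by (auto simp: inv_def)
        ultimately show ?thesis by simp
      qed
    qed
    show "\<forall>t\<in>insert u T. \<forall>v\<in>V - insert u T. ?z t - y t \<le> ?z v - y v"
    proof (intro ballI)
      fix t v assume "t \<in> insert u T" "v \<in> V - insert u T"
      then have "?z t = x t" "x u - y u \<le> ?z v - y v" "x t - y t \<le> x u - y u"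
        using i le by (auto simp: inv_def)
      then show "?z t - y t \<le> ?z v - y v" by linarith
    qed
  qed
  with u show ?thesis by blast
qed

text \<open>One vertex settles per round, so after \<open>card V\<close> rounds the settled set is
  all of \<open>V\<close> and every edge holds; conversely the computed vector is itself a solution.
  The start \<open>x\<close> is arbitrary: its entries act as the weights of edges from an extra
  source.\<close>

theorem bellman_ford:
  assumes "finite V" "set es \<subseteq> V \<times> V \<times> UNIV"
  shows "(\<exists>y. \<forall>e\<in>set es. sat e y) \<longleftrightarrow> (\<forall>e\<in>set es. sat e ((fold relax es ^^ card V) x))"
proof
  assume "\<exists>y. \<forall>e\<in>set es. sat e y"
  then obtain y where y: "\<forall>e\<in>set es. sat e y" ..
  have "\<exists>T. settled es V y T ((fold relax es ^^ k) x) \<and> card T = k" if "k \<le> card V" for k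
    using that
  proof (induction k)
    case 0
    then show ?case by (auto simp: settled_def intro!: exI[of _ "{}"])
  next
    case (Suc k)
    then obtain T where T: "settled es V y T ((fold relax es ^^ k) x)" "card T = k" by auto
    then have "T \<noteq> V" using Suc.prems by auto
    then obtain u where u: "u \<in> V - T" "settled es V y (insert u T) ((fold relax es ^^ Suc k) x)"
      using settled_round[OF assms y T(1)] by auto
    have "finite T" using T(1) assms(1) by (auto simp: settled_def intro: finite_subset)
    then show ?case using u T(2) by auto
  qed
  then obtain T where T: "settled es V y T ((fold relax es ^^ card V) x)" "card T = card V" by auto
  then have "T = V" using assms(1) by (simp add: settled_def card_subset_eq)
  then show "\<forall>e\<in>set es. sat e ((fold relax es ^^ card V) x)"
    using T(1) assms(2) unfolding settled_def by fastforce
qed blast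

section \<open>Time-bounded Hoare triples for machine code\<close>

type_synonym mem = "nat \<Rightarrow> int"

text \<open>A program fragment is given its start address because jump targets are absolute.\<close>

type_synonym frag = "nat \<Rightarrow> instr list"

text \<open>Arbitrary surrounding code \<open>pre\<close> and \<open>post\<close> makes runs of
  adjacent fragments composable.\<close>

definition reaches :: "frag \<Rightarrow> mem \<Rightarrow> nat \<Rightarrow> mem \<Rightarrow> bool" where
  "reaches c m t m' \<longleftrightarrow> (\<forall>pre post. run (pre @ c (length pre) @ post) t (length pre, m) =
     (length pre + length (c (length pre)), m'))"

definition hoare :: "(mem \<Rightarrow> bool) \<Rightarrow> frag \<Rightarrow> nat \<Rightarrow> (mem \<Rightarrow> bool) \<Rightarrow> bool" where
  "hoare P c T Q \<longleftrightarrow> (\<forall>m. P m \<longrightarrow> (\<exists>t\<le>T. \<exists>m'. reaches c m t m' \<and> Q m'))"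

fun straight :: "instr \<Rightarrow> bool" where
  "straight (JmpLeZ r t) = False"
| "straight Halt = False"
| "straight _ = True"

definition eff :: "instr \<Rightarrow> mem \<Rightarrow> mem" where
  "eff i m = snd (exec i (0, m))"

definition seq :: "frag \<Rightarrow> frag \<Rightarrow> frag" (infixr ";;" 60) where
  "(c1 ;; c2) p = c1 p @ c2 (p + length (c1 p))"

definition if_pos :: "nat \<Rightarrow> frag \<Rightarrow> frag" where
  "if_pos r c p = JmpLeZ r (p + 1 + length (c (p + 1))) # c (p + 1)"

text \<open>Register 0 is cleared to make the jump back unconditional.\<close>

definition while_pos :: "nat \<Rightarrow> frag \<Rightarrow> frag" where
  "while_pos r c p = JmpLeZ r (p + 3 + length (c (p + 1))) # c (p + 1) @ [LoadC 0 0, JmpLeZ 0 p]"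

section \<open>Execution of composed code\<close>

lemma run_0: "run prog 0 cfg = cfg"
  by (simp add: run_def)

lemma run_add: "run prog (s + t) cfg = run prog t (run prog s cfg)"
  by (simp add: run_def funpow_add add.commute[of s])

lemma run_step: "run (pre @ i # post) (Suc t) (length pre, m) =
  run (pre @ i # post) t (if i = Halt then (length pre, m) else exec i (length pre, m))"
  by (simp add: run_def funpow_Suc_right step_def halted_def del: funpow.simps)

lemma exec_straight: "straight i \<Longrightarrow> exec i (p, m) = (p + 1, eff i m) \<and> i \<noteq> Halt"
  by (cases i) (auto simp: eff_def)

lemma reaches_basic:
  assumes "\<forall>i\<in>set is. straight i"
  shows "reaches (\<lambda>_. is) m (length is) (fold eff is m)"
proof -
  have "run (pre @ is @ post) (length is) (length pre, m) = (length pre + length is, fold eff is m)"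
    for pre post
    using assms
  proof (induction "is" arbitrary: pre m)
    case (Cons i "is")
    then show ?case
      using exec_straight[of i "length pre" m] Cons.IH[of "pre @ [i]"] by (simp add: run_step)
  qed (simp add: run_0)
  then show ?thesis by (simp add: reaches_def)
qed

lemma reaches_seq:
  assumes "reaches c1 m s m'" "reaches c2 m' t m''"
  shows "reaches (c1 ;; c2) m (s + t) m''"
  unfolding reaches_def
proof (intro allI)
  fix pre post :: "instr list"
  let ?c1 = "c1 (length pre)" and ?c2 = "c2 (length pre + length (c1 (length pre)))"
  have "run (pre @ ?c1 @ ?c2 @ post) s (length pre, m) = (length pre + length ?c1, m')"
    using assms(1) unfolding reaches_def by blast
  moreover have "run ((pre @ ?c1) @ ?c2 @ post) t (length (pre @ ?c1), m') =
      (length (pre @ ?c1) + length ?c2, m'')"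
    using assms(2) unfolding reaches_def by (metis length_append)
  ultimately show "run (pre @ (c1 ;; c2) (length pre) @ post) (s + t) (length pre, m) =
    (length pre + length ((c1 ;; c2) (length pre)), m'')"
    by (simp add: seq_def run_add)
qed

lemma reaches_if_skip: "m r \<le> 0 \<Longrightarrow> reaches (if_pos r c) m 1 m"
  using run_step[where t = 0] by (simp add: reaches_def if_pos_def run_0)

lemma reaches_if_take:
  assumes "m r > 0" "reaches c m t m'"
  shows "reaches (if_pos r c) m (Suc t) m'"
  unfolding reaches_def
proof (intro allI)
  fix pre post :: "instr list"
  let ?i = "JmpLeZ r (length pre + 1 + length (c (length pre + 1)))"
  have "run ((pre @ [?i]) @ c (length (pre @ [?i])) @ post) t (length (pre @ [?i]), m) =
    (length (pre @ [?i]) + length (c (length (pre @ [?i]))), m')"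
    using assms(2) unfolding reaches_def by blast
  then show "run (pre @ if_pos r c (length pre) @ post) (Suc t) (length pre, m) =
      (length pre + length (if_pos r c (length pre)), m')"
    using assms(1) by (simp add: if_pos_def run_step)
qed

lemma reaches_while_exit: "m r \<le> 0 \<Longrightarrow> reaches (while_pos r c) m 1 m"
  using run_step[where t = 0] by (simp add: reaches_def while_pos_def run_0 add.assoc)

lemma reaches_while_step:
  assumes r: "m r > 0" and c: "reaches c m s m'" and w: "reaches (while_pos r c) (m'(0 := 0)) t m''"
  shows "reaches (while_pos r c) m (s + t + 3) m''"
  unfolding reaches_def
proof (intro allI)
  fix pre post :: "instr list"
  let ?p = "length pre"
  let ?c = "c (?p + 1)"
  let ?i = "JmpLeZ r (?p + 3 + length ?c)"
  let ?prog = "pre @ while_pos r c ?p @ post"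
  have prog1: "?prog = pre @ ?i # ?c @ LoadC 0 0 # JmpLeZ 0 ?p # post"
    and prog2: "?prog = (pre @ [?i]) @ c (length (pre @ [?i])) @ (LoadC 0 0 # JmpLeZ 0 ?p # post)"
    and prog3: "?prog = (pre @ ?i # ?c) @ LoadC 0 0 # JmpLeZ 0 ?p # post"
    and prog4: "?prog = (pre @ ?i # ?c @ [LoadC 0 0]) @ JmpLeZ 0 ?p # post"
    by (simp_all add: while_pos_def)
  have 1: "run ?prog (Suc 0) (?p, m) = (?p + 1, m)"
    unfolding prog1 run_step using r by (simp add: run_0)
  have 2: "run ?prog s (?p + 1, m) = (?p + 1 + length ?c, m')"
    using c[unfolded reaches_def, rule_format, of "pre @ [?i]" "LoadC 0 0 # JmpLeZ 0 ?p # post"]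
    unfolding prog2 by simp
  have 3: "run ?prog (Suc 0) (?p + 1 + length ?c, m') = (?p + 2 + length ?c, m'(0 := 0))"
    using run_step[of "pre @ ?i # ?c" "LoadC 0 0" "JmpLeZ 0 ?p # post" 0 m'] unfolding prog3
    by (simp add: run_0)
  have 4: "run ?prog (Suc 0) (?p + 2 + length ?c, m'(0 := 0)) = (?p, m'(0 := 0))"
    using run_step[of "pre @ ?i # ?c @ [LoadC 0 0]" "JmpLeZ 0 ?p" post 0 "m'(0 := 0)"] unfolding prog4
    by (simp add: run_0)
  have 5: "run ?prog t (?p, m'(0 := 0)) = (?p + length (while_pos r c ?p), m'')"
    using w unfolding reaches_def by blast
  have "s + t + 3 = Suc 0 + (s + (Suc 0 + (Suc 0 + t)))" by simp
  then show "run ?prog (s + t + 3) (?p, m) = (?p + length (while_pos r c ?p), m'')"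
    by (simp only: run_add 1 2 3 4 5)
qed

section \<open>Proof rules with time bounds\<close>

lemma hoareI: "(\<And>m. P m \<Longrightarrow> \<exists>m'. reaches c m T m' \<and> Q m') \<Longrightarrow> hoare P c T Q"
  unfolding hoare_def by blast

lemma hoare_weaken:
  "hoare P c T Q \<Longrightarrow> (\<And>m. P' m \<Longrightarrow> P m) \<Longrightarrow> T \<le> T' \<Longrightarrow> (\<And>m. Q m \<Longrightarrow> Q' m) \<Longrightarrow> hoare P' c T' Q'"
  unfolding hoare_def by (meson le_trans)

lemma hoare_basic:
  assumes "\<forall>i\<in>set is. straight i" "\<And>m. P m \<Longrightarrow> Q (fold eff is m)"
  shows "hoare P (\<lambda>_. is) (length is) Q"
  using assms reaches_basic by (intro hoareI) blast

lemma hoare_seq: "hoare P c1 S Q \<Longrightarrow> hoare Q c2 T R \<Longrightarrow> hoare P (c1 ;; c2) (S + T) R"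
  unfolding hoare_def by (meson add_mono reaches_seq)

lemma hoare_if:
  assumes "hoare (\<lambda>m. P m \<and> m r > 0) c T Q" "\<And>m. P m \<Longrightarrow> m r \<le> 0 \<Longrightarrow> Q m"
  shows "hoare P (if_pos r c) (Suc T) Q"
  unfolding hoare_def
proof (intro allI impI)
  fix m assume "P m"
  show "\<exists>t\<le>Suc T. \<exists>m'. reaches (if_pos r c) m t m' \<and> Q m'"
  proof (cases "m r > 0")
    case True
    then obtain t m' where "t \<le> T" "reaches c m t m'" "Q m'"
      using assms(1) \<open>P m\<close> unfolding hoare_def by blast
    then show ?thesis using reaches_if_take[of m r c t m'] True by (meson Suc_le_mono)
  next
    case False
    then show ?thesis using reaches_if_skip[of m r c] assms(2) \<open>P m\<close> by fastforce
  qed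
qed

text \<open>The index of \<open>I\<close> is the number of iterations left, so the invariant also
  proves termination. An iteration costs its body plus 3 for the test, the clearing of register 0
  and the jump; the final test costs 1. The invariant is demanded only after the clearing, so a body
  may use register 0 as scratch.\<close>

lemma hoare_while:
  assumes body: "\<And>k. k < n \<Longrightarrow> hoare (I (Suc k)) c T (\<lambda>m. I k (m(0 := 0)))"
    and pos: "\<And>k m. I (Suc k) m \<Longrightarrow> m r > 0" and zero: "\<And>m. I 0 m \<Longrightarrow> m r \<le> 0"
  shows "hoare (I n) (while_pos r c) (n * (T + 3) + 1) (I 0)"
  using body
proof (induction n)
  case 0
  then show ?case using zero reaches_while_exit by (intro hoareI) fastforce
next
  case (Suc n)
  show ?case
    unfolding hoare_def
  proof (intro allI impI)
    fix m assume m: "I (Suc n) m"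
    then obtain s m' where s: "s \<le> T" "reaches c m s m'" "I n (m'(0 := 0))"
      using Suc.prems[of n] unfolding hoare_def by blast
    then obtain t m'' where t: "t \<le> n * (T + 3) + 1" "reaches (while_pos r c) (m'(0 := 0)) t m''" "I 0 m''"
      using Suc unfolding hoare_def by (metis less_SucI)
    have "s + t + 3 \<le> Suc n * (T + 3) + 1" using s(1) t(1) by simp
    then show "\<exists>t\<le>Suc n * (T + 3) + 1. \<exists>m'. reaches (while_pos r c) m t m' \<and> I 0 m'"
      using reaches_while_step[OF pos[OF m] s(2) t(2)] t(3) by blast
  qed
qed

lemma hoare_halts:
  assumes "hoare P c T Q" "P m"
  shows "\<exists>k\<le>T. halted (c 0) (run (c 0) k (0, m)) \<and> Q (snd (run (c 0) k (0, m)))"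
proof -
  obtain t m' where "t \<le> T" "reaches c m t m'" "Q m'" using assms unfolding hoare_def by blast
  moreover from this(2) have "run (c 0) t (0, m) = (length (c 0), m')"
    unfolding reaches_def by (metis append_Nil append_Nil2 add_0 list.size(3))
  ultimately show ?thesis by (intro exI[of _ t]) (simp add: halted_def)
qed

section \<open>Code emitting edges\<close>

text \<open>Registers below 41 are scratch space. Straight-line code that appends edges to a list in
  memory starting at address E, whose end is kept in register 14. Register 40 is a temporary.\<close>

datatype gop = Const nat int | Plus nat nat nat | Minus nat nat nat | Load nat nat
  | Minimum nat nat | Maximum nat nat | Emit nat nat nat

fun code :: "gop \<Rightarrow> frag" where
  "code (Const r v) = (\<lambda>_. [LoadC r v])"
| "code (Plus r a b) = (\<lambda>_. [Add r a b])"
| "code (Minus r a b) = (\<lambda>_. [Sub r a b])"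
| "code (Load r a) = (\<lambda>_. [LoadI r a])"
| "code (Minimum r a) = (\<lambda>_. [Sub 40 r a]) ;; if_pos 40 (\<lambda>_. [Add r a 0])"
| "code (Maximum r a) = (\<lambda>_. [Sub 40 a r]) ;; if_pos 40 (\<lambda>_. [Add r a 0])"
| "code (Emit u v w) = (\<lambda>_. [StoreI 14 u, Add 14 14 9, StoreI 14 v, Add 14 14 9, StoreI 14 w, Add 14 14 9])"

text \<open>Symbolic semantics: registers and emitted edges are computed apart from the machine
  memory, so a long sequence of operations can be verified by simplification. \<open>H\<close>
  supplies the cells that stay fixed while edges are emitted.\<close>

fun regs :: "mem \<Rightarrow> gop \<Rightarrow> mem \<Rightarrow> mem" where
  "regs H (Const r v) R = R(r := v)"
| "regs H (Plus r a b) R = R(r := R a + R b)"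
| "regs H (Minus r a b) R = R(r := R a - R b)"
| "regs H (Load r a) R = R(r := H (nat (R a)))"
| "regs H (Minimum r a) R = R(r := min (R r) (R a))"
| "regs H (Maximum r a) R = R(r := max (R r) (R a))"
| "regs H (Emit u v w) R = R"

fun emitted :: "gop \<Rightarrow> mem \<Rightarrow> (nat \<times> nat \<times> int) list" where
  "emitted (Emit u v w) R = [(nat (R u), nat (R v), R w)]"
| "emitted _ R = []"

text \<open>Operations cannot name the write pointer 14 or the temporary 40, and cannot overwrite
  the constants 0 and 1 in registers 0 and 9.\<close>

definition src :: "nat \<Rightarrow> bool" where "src r \<longleftrightarrow> r < 40 \<and> r \<noteq> 14"
definition dst :: "nat \<Rightarrow> bool" where "dst r \<longleftrightarrow> src r \<and> r \<noteq> 0 \<and> r \<noteq> 9"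

fun gop_ok :: "nat \<Rightarrow> mem \<Rightarrow> gop \<Rightarrow> bool" where
  "gop_ok E R (Const r v) \<longleftrightarrow> dst r"
| "gop_ok E R (Plus r a b) \<longleftrightarrow> dst r \<and> src a \<and> src b"
| "gop_ok E R (Minus r a b) \<longleftrightarrow> dst r \<and> src a \<and> src b"
| "gop_ok E R (Load r a) \<longleftrightarrow> dst r \<and> src a \<and> 41 \<le> nat (R a) \<and> nat (R a) < E"
| "gop_ok E R (Minimum r a) \<longleftrightarrow> dst r \<and> src a"
| "gop_ok E R (Maximum r a) \<longleftrightarrow> dst r \<and> src a"
| "gop_ok E R (Emit u v w) \<longleftrightarrow> src u \<and> src v \<and> src w"

fun gops_code :: "gop list \<Rightarrow> frag" where
  "gops_code [] = (\<lambda>_. [])"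
| "gops_code (p # ps) = code p ;; gops_code ps"

fun gops_regs :: "mem \<Rightarrow> gop list \<Rightarrow> mem \<Rightarrow> mem" where
  "gops_regs H [] R = R"
| "gops_regs H (p # ps) R = gops_regs H ps (regs H p R)"

fun gops_emitted :: "mem \<Rightarrow> gop list \<Rightarrow> mem \<Rightarrow> (nat \<times> nat \<times> int) list" where
  "gops_emitted H [] R = []"
| "gops_emitted H (p # ps) R = emitted p R @ gops_emitted H ps (regs H p R)"

fun gops_ok :: "nat \<Rightarrow> mem \<Rightarrow> gop list \<Rightarrow> mem \<Rightarrow> bool" where
  "gops_ok E H [] R \<longleftrightarrow> True"
| "gops_ok E H (p # ps) R \<longleftrightarrow> gop_ok E R p \<and> gops_ok E H ps (regs H p R)"

definition edges_at :: "nat \<Rightarrow> (nat \<times> nat \<times> int) list \<Rightarrow> mem \<Rightarrow> bool" where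
  "edges_at E es m \<longleftrightarrow> (\<forall>k<length es. case es ! k of (u, v, w) \<Rightarrow>
     nat (m (E + 3 * k)) = u \<and> nat (m (E + 3 * k + 1)) = v \<and> m (E + 3 * k + 2) = w)"

lemma edges_at_cong: "edges_at E es m \<Longrightarrow> (\<And>j. E \<le> j \<Longrightarrow> j < E + 3 * length es \<Longrightarrow> m' j = m j) \<Longrightarrow> edges_at E es m'"
  unfolding edges_at_def by (auto split: prod.splits)

lemma edges_at_snoc:
  "edges_at E (es @ [(u, v, w)]) m \<longleftrightarrow> edges_at E es m \<and> nat (m (E + 3 * length es)) = u \<and>
     nat (m (E + 3 * length es + 1)) = v \<and> m (E + 3 * length es + 2) = w"
  unfolding edges_at_def by (auto simp: All_less_Suc nth_append)

definition gen_state :: "nat \<Rightarrow> mem \<Rightarrow> mem \<Rightarrow> (nat \<times> nat \<times> int) list \<Rightarrow> mem \<Rightarrow> bool" where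
  "gen_state E H R es m \<longleftrightarrow> (\<forall>r<40. r \<noteq> 14 \<longrightarrow> m r = R r) \<and> R 0 = 0 \<and> R 9 = 1 \<and>
     m 14 = int (E + 3 * length es) \<and> (\<forall>j. 41 \<le> j \<and> j < E \<longrightarrow> m j = H j) \<and> edges_at E es m"

lemma gen_state_regs:
  assumes "gen_state E H R es m" "41 \<le> E" "\<And>r. r < 40 \<Longrightarrow> r \<noteq> 14 \<Longrightarrow> m' r = R' r" "R' 0 = 0" "R' 9 = 1"
    "m' 14 = m 14" "\<And>j. 41 \<le> j \<Longrightarrow> m' j = m j"
  shows "gen_state E H R' es m'"
  using assms edges_at_cong[of E es m m'] unfolding gen_state_def by auto

lemma gen_state_upd:
  assumes "gen_state E H R es m" "41 \<le> E" "dst r"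
  shows "gen_state E H (R(r := v)) es (m(r := v))"
  using assms by (intro gen_state_regs[OF assms(1,2)]) (auto simp: gen_state_def dst_def src_def)

lemma gen_state_tmp:
  assumes "gen_state E H R es m" "41 \<le> E"
  shows "gen_state E H R es (m(40 := v))"
  using assms by (intro gen_state_regs[OF assms(1,2)]) (auto simp: gen_state_def)

lemma gen_state_src: "gen_state E H R es m \<Longrightarrow> src r \<Longrightarrow> m r = R r"
  by (auto simp: gen_state_def src_def)

lemma hoare_basic':
  assumes "\<forall>i\<in>set is. straight i" "\<And>m. P m \<Longrightarrow> Q (fold eff is m)" "length is \<le> T"
  shows "hoare P (\<lambda>_. is) T Q"
  using hoare_weaken[OF hoare_basic[of "is" P Q, OF assms(1,2)]] assms(3) by blast

text \<open>Common form of \<open>Minimum\<close> and \<open>Maximum\<close>: the sign of a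
  difference in register 40 decides, and adding register 0 amounts to a copy.\<close>

lemma hoare_select:
  assumes g: "41 \<le> E" "dst r" "src a" "src b" "src c"
    and v: "v = (if R b - R c > 0 then R a else R r)"
  shows "hoare (gen_state E H R es) ((\<lambda>_. [Sub 40 b c]) ;; if_pos 40 (\<lambda>_. [Add r a 0])) 6
    (gen_state E H (R(r := v)) es)"
proof -
  have "hoare (gen_state E H R es) (\<lambda>_. [Sub 40 b c]) (length [Sub 40 b c])
     (\<lambda>m. gen_state E H R es m \<and> m 40 = R b - R c)"
    using g by (intro hoare_basic) (auto simp: eff_def gen_state_tmp gen_state_src)
  moreover have "hoare (\<lambda>m. gen_state E H R es m \<and> m 40 = R b - R c) (if_pos 40 (\<lambda>_. [Add r a 0]))
     (Suc (length [Add r a 0])) (gen_state E H (R(r := v)) es)"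
  proof (intro hoare_if hoare_basic)
    show "gen_state E H (R(r := v)) es (fold eff [Add r a 0] m)"
      if "(gen_state E H R es m \<and> m 40 = R b - R c) \<and> 0 < m 40" for m
    proof -
      have "m a = R a" "m 0 = 0" using that g gen_state_src[of E H R es m a]
        by (auto simp: gen_state_def)
      moreover have "v = R a" using that v by simp
      ultimately show ?thesis using that g by (simp add: eff_def gen_state_upd)
    qed
    show "gen_state E H (R(r := v)) es m" if "gen_state E H R es m \<and> m 40 = R b - R c" "m 40 \<le> 0" for m
    proof -
      have "R(r := v) = R" using that v by (auto simp: fun_eq_iff)
      then show ?thesis using that by simp
    qed
  qed simp
  ultimately have "hoare (gen_state E H R es) ((\<lambda>_. [Sub 40 b c]) ;; if_pos 40 (\<lambda>_. [Add r a 0]))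
     (length [Sub 40 b c] + Suc (length [Add r a 0])) (gen_state E H (R(r := v)) es)"
    by (rule hoare_seq)
  then show ?thesis by (rule hoare_weaken) auto
qed

lemma hoare_emit:
  assumes E: "41 \<le> E" and s: "src u" "src v" "src w"
  shows "hoare (gen_state E H R es) (code (Emit u v w)) 6
    (gen_state E H R (es @ [(nat (R u), nat (R v), R w)]))"
  unfolding code.simps
proof (rule hoare_basic')
  fix m assume m: "gen_state E H R es m"
  define p where "p = E + 3 * length es"
  have m14: "m 14 = int p" and m9: "m 9 = 1" and p: "41 \<le> p"
    using m E by (auto simp: gen_state_def p_def)
  have n: "nat (int p) = p" "nat (int p + 1) = p + 1" "nat (int p + 1 + 1) = p + 2" by auto
  let ?m = "m(14 := int p + 3, p := R u, p + 1 := R v, p + 2 := R w)"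
  have "m u = R u" "m v = R v" "m w = R w" using gen_state_src[OF m] s by auto
  then have eq: "fold eff [StoreI 14 u, Add 14 14 9, StoreI 14 v, Add 14 14 9, StoreI 14 w, Add 14 14 9] m = ?m"
    using m14 m9 p s by (auto simp: eff_def fun_eq_iff n src_def)
  have "edges_at E es ?m"
    using m edges_at_cong[of E es m ?m] E unfolding gen_state_def p_def by auto
  then have "gen_state E H R (es @ [(nat (R u), nat (R v), R w)]) ?m"
    using m p E unfolding gen_state_def edges_at_snoc by (auto simp: p_def)
  then show "gen_state E H R (es @ [(nat (R u), nat (R v), R w)])
    (fold eff [StoreI 14 u, Add 14 14 9, StoreI 14 v, Add 14 14 9, StoreI 14 w, Add 14 14 9] m)"
    unfolding eq .
qed auto

text \<open>The bound 6 is the length of \<open>Emit\<close>, the longest operation.\<close>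

lemma hoare_gop:
  assumes "41 \<le> E" "gop_ok E R p"
  shows "hoare (gen_state E H R es) (code p) 6 (gen_state E H (regs H p R) (es @ emitted p R))"
proof (cases p)
  case (Minimum r a)
  then show ?thesis using assms hoare_select[of E r a r a "min (R r) (R a)" R H es]
    by (auto simp: dst_def min_def)
next
  case (Maximum r a)
  then show ?thesis using assms hoare_select[of E r a a r "max (R r) (R a)" R H es]
    by (auto simp: dst_def max_def)
next
  case (Emit u v w)
  then show ?thesis using assms hoare_emit[of E u v w] by simp
next
  case (Load r a)
  have "m (nat (m a)) = H (nat (R a))" if "gen_state E H R es m" for m
    using that assms gen_state_src[OF that, of a] Load by (auto simp: gen_state_def)
  then show ?thesis using assms Load
    by (auto intro!: hoare_basic' simp: eff_def gen_state_upd gen_state_src)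
qed (use assms in \<open>auto intro!: hoare_basic' simp: eff_def gen_state_upd gen_state_src\<close>)

lemma hoare_gops:
  assumes "41 \<le> E" "gops_ok E H ps R"
  shows "hoare (gen_state E H R es) (gops_code ps) (6 * length ps)
    (gen_state E H (gops_regs H ps R) (es @ gops_emitted H ps R))"
  using assms(2)
proof (induction ps arbitrary: R es)
  case Nil
  then show ?case by (auto intro: hoare_basic')
next
  case (Cons p ps)
  then have "hoare (gen_state E H R es) (code p ;; gops_code ps) (6 + 6 * length ps)
    (gen_state E H (gops_regs H ps (regs H p R)) ((es @ emitted p R) @ gops_emitted H ps (regs H p R)))"
    using hoare_seq[OF hoare_gop[OF assms(1), of R p H es] Cons.IH[of "regs H p R" "es @ emitted p R"]] by simp
  then show ?case by simp
qed

section \<open>Bellman-Ford on the machine\<close>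

text \<open>A vertex is the address of the cell holding its value, so an edge can be followed by one
  indirect load. Vertices lie between the registers and \<open>E\<close>; updating them therefore
  leaves the edge list intact.\<close>

definition bf_state :: "nat \<Rightarrow> (nat \<times> nat \<times> int) list \<Rightarrow> mem \<Rightarrow> mem \<Rightarrow> bool" where
  "bf_state E es x m \<longleftrightarrow> m 0 = 0 \<and> m 9 = 1 \<and> m 14 = int (E + 3 * length es) \<and> m 25 = int E \<and>
     edges_at E es m \<and> (\<forall>v\<in>{41..<E}. m v = x v)"

text \<open>Register 23 walks through the edge list, 24 counts the cells left and 26 records a
  change. Counting cells instead of edges lets the counter start as end minus begin, without
  division.\<close>

definition relax_edge :: frag where
  "relax_edge = (\<lambda>_. [LoadI 16 23, Add 23 23 9, LoadI 17 23, Add 23 23 9, LoadI 18 23, Add 23 23 9,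
     LoadI 16 16, Add 16 16 18, LoadI 18 17, Sub 18 18 16, LoadC 19 3, Sub 24 24 19]) ;;
     if_pos 18 (\<lambda>_. [StoreI 17 16, LoadC 26 1])"

definition relax_round :: frag where
  "relax_round = (\<lambda>_. [LoadC 26 0, Add 23 25 0, Sub 24 14 25, Sub 22 22 9]) ;; while_pos 24 relax_edge"

lemma bf_state_scratch:
  assumes "bf_state E es x m" "41 \<le> E" "\<And>j. 41 \<le> j \<Longrightarrow> m' j = m j"
    "m' 0 = m 0" "m' 9 = m 9" "m' 14 = m 14" "m' 25 = m 25"
  shows "bf_state E es x m'"
  using assms edges_at_cong[of E es m m'] unfolding bf_state_def by auto

lemma hoare_relax_edge:
  assumes E: "41 \<le> E" and j: "j < length es" and e: "es ! j = (u, v, w)"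
    and uv: "u \<in> {41..<E}" "v \<in> {41..<E}"
  shows "hoare (\<lambda>m. bf_state E es x m \<and> m 23 = int (E + 3 * j) \<and> m 24 = d \<and> m 22 = c \<and> m 26 = f)
    relax_edge 15
    (\<lambda>m. bf_state E es (relax (u, v, w) x) m \<and> m 23 = int (E + 3 * Suc j) \<and> m 24 = d - 3 \<and> m 22 = c \<and>
       m 26 = (if sat (u, v, w) x then f else 1))"
proof -
  let ?mid = "\<lambda>m. bf_state E es x m \<and> m 23 = int (E + 3 * Suc j) \<and> m 24 = d - 3 \<and> m 22 = c \<and> m 26 = f \<and>
    m 16 = x u + w \<and> nat (m 17) = v \<and> m 18 = x v - (x u + w)"
  let ?load = "[LoadI 16 23, Add 23 23 9, LoadI 17 23, Add 23 23 9, LoadI 18 23, Add 23 23 9,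
     LoadI 16 16, Add 16 16 18, LoadI 18 17, Sub 18 18 16, LoadC 19 3, Sub 24 24 19]"
  have "hoare (\<lambda>m. bf_state E es x m \<and> m 23 = int (E + 3 * j) \<and> m 24 = d \<and> m 22 = c \<and> m 26 = f)
    (\<lambda>_. ?load) (length ?load) ?mid"
  proof (intro hoare_basic)
    fix m assume m: "bf_state E es x m \<and> m 23 = int (E + 3 * j) \<and> m 24 = d \<and> m 22 = c \<and> m 26 = f"
    define p where "p = E + 3 * j"
    have p: "41 \<le> p" "m 23 = int p" "m 9 = 1" using m E by (auto simp: p_def bf_state_def)
    have es: "nat (m p) = u" "nat (m (p + 1)) = v" "m (p + 2) = w"
      using m j e by (auto simp: bf_state_def edges_at_def p_def split: prod.splits)
    have x: "m u = x u" "m v = x v" using m uv by (auto simp: bf_state_def)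
    have n: "nat (int p) = p" "nat (int p + 1) = p + 1" "nat (2 + int p) = p + 2" by auto
    let ?m = "m(16 := x u + w, 23 := int p + 3, 17 := m (p + 1), 18 := x v - (x u + w), 19 := 3, 24 := d - 3)"
    have "fold eff ?load m = ?m"
      using p es x uv m by (auto simp: eff_def fun_eq_iff n)
    moreover have "bf_state E es x ?m"
      by (rule bf_state_scratch[OF _ E, of es x m]) (use m in auto)
    ultimately show "?mid (fold eff ?load m)" using m es by (simp add: p_def)
  qed simp
  moreover have "hoare ?mid (if_pos 18 (\<lambda>_. [StoreI 17 16, LoadC 26 1])) (Suc (length [StoreI 17 16, LoadC 26 1]))
    (\<lambda>m. bf_state E es (relax (u, v, w) x) m \<and> m 23 = int (E + 3 * Suc j) \<and> m 24 = d - 3 \<and> m 22 = c \<and>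
       m 26 = (if sat (u, v, w) x then f else 1))" (is "hoare _ _ _ ?post")
  proof (intro hoare_if hoare_basic)
    fix m assume m: "?mid m \<and> 0 < m 18"
    let ?m = "m(v := x u + w, 26 := 1)"
    have eq: "fold eff [StoreI 17 16, LoadC 26 1] m = ?m" using m by (simp add: eff_def)
    have "edges_at E es ?m"
      using m uv E by (intro edges_at_cong[of E es m ?m]) (auto simp: bf_state_def)
    then have "bf_state E es (relax (u, v, w) x) ?m"
      using m uv unfolding bf_state_def by auto
    then show "?post (fold eff [StoreI 17 16, LoadC 26 1] m)"
      unfolding eq using m uv by auto
  next
    fix m assume m: "?mid m" "m 18 \<le> 0"
    then have "sat (u, v, w) x" by simp
    then show "?post m" using m relax_sat[of "(u, v, w)" x] by simp
  qed simp
  ultimately show ?thesis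
    unfolding relax_edge_def using hoare_weaken[OF hoare_seq] by fastforce
qed

lemma hoare_relax_round:
  assumes E: "41 \<le> E" and es: "set es \<subseteq> {41..<E} \<times> {41..<E} \<times> UNIV"
  shows "hoare (\<lambda>m. bf_state E es x m \<and> m 22 = c) relax_round (5 + 18 * length es)
    (\<lambda>m. bf_state E es (fold relax es x) m \<and> m 22 = c - 1 \<and> m 26 = of_bool (\<exists>e\<in>set es. \<not> sat e x))"
proof -
  let ?n = "length es"
  define I where "I k m \<longleftrightarrow> k \<le> ?n \<and> bf_state E es (fold relax (take (?n - k) es) x) m \<and>
    m 23 = int (E + 3 * (?n - k)) \<and> m 24 = 3 * int k \<and> m 22 = c - 1 \<and>
    m 26 = of_bool (\<exists>e\<in>set (take (?n - k) es). \<not> sat e x)" for k m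
  let ?init = "[LoadC 26 0, Add 23 25 0, Sub 24 14 25, Sub 22 22 9]"
  have "hoare (\<lambda>m. bf_state E es x m \<and> m 22 = c) (\<lambda>_. ?init) (length ?init) (I ?n)"
  proof (intro hoare_basic)
    fix m assume m: "bf_state E es x m \<and> m 22 = c"
    have r: "m 25 = int E" "m 14 = int (E + 3 * ?n)" "m 9 = 1" "m 0 = 0" using m by (auto simp: bf_state_def)
    have "bf_state E es x (fold eff ?init m)"
      by (rule bf_state_scratch[OF _ E, of es x m]) (use m in \<open>auto simp: eff_def\<close>)
    then show "I ?n (fold eff ?init m)" using m r by (simp add: I_def eff_def)
  qed simp
  moreover have "hoare (I ?n) (while_pos 24 relax_edge) (?n * (15 + 3) + 1) (I 0)"
  proof (rule hoare_while)
    fix k assume k: "k < ?n"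
    let ?j = "?n - Suc k"
    have j: "?j < ?n" "?n - k = Suc ?j" using k by auto
    obtain u v w where e: "es ! ?j = (u, v, w)" by (cases "es ! ?j")
    then have uv: "u \<in> {41..<E}" "v \<in> {41..<E}" using es nth_mem[OF j(1)] by auto
    let ?x = "fold relax (take ?j es) x"
    have take: "take (?n - k) es = take ?j es @ [(u, v, w)]"
      using j e by (simp add: take_Suc_conv_app_nth)
    have z: "fold relax (take (?n - k) es) x = relax (u, v, w) ?x" by (simp add: take)
    \<comment> \<open>As long as the flag is 0 no value has changed, so each test still refers to
      the values at the start of the round.\<close>
    have flag: "(if sat (u, v, w) ?x then of_bool (\<exists>e\<in>set (take ?j es). \<not> sat e x) else 1) =
       (of_bool (\<exists>e\<in>set (take (?n - k) es). \<not> sat e x) :: int)"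
      using fold_relax_sat[of "take ?j es" x] unfolding take by (cases "\<exists>e\<in>set (take ?j es). \<not> sat e x") auto
    show "hoare (I (Suc k)) relax_edge 15 (\<lambda>m. I k (m(0 := 0)))"
    proof (rule hoare_weaken[OF hoare_relax_edge[OF E j(1) e uv, of ?x "3 * int (Suc k)" "c - 1"
          "of_bool (\<exists>e\<in>set (take ?j es). \<not> sat e x)"]])
      fix m assume m: "bf_state E es (relax (u, v, w) ?x) m \<and> m 23 = int (E + 3 * Suc ?j) \<and>
         m 24 = 3 * int (Suc k) - 3 \<and> m 22 = c - 1 \<and>
         m 26 = (if sat (u, v, w) ?x then of_bool (\<exists>e\<in>set (take ?j es). \<not> sat e x) else 1)"
      have "m(0 := 0) = m" using m by (auto simp: bf_state_def)
      moreover have "I k m" unfolding I_def using m k unfolding flag z[symmetric] j(2)[symmetric] by simp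
      ultimately show "I k (m(0 := 0))" by simp
    qed (auto simp: I_def)
  qed (auto simp: I_def)
  ultimately have "hoare (\<lambda>m. bf_state E es x m \<and> m 22 = c) relax_round
      (length ?init + (?n * (15 + 3) + 1)) (I 0)"
    unfolding relax_round_def by (rule hoare_seq)
  then show ?thesis by (rule hoare_weaken) (auto simp: I_def)
qed

text \<open>Every round resets the flag, so in the end it speaks of the last round alone, that is,
  of the values after \<open>n\<close> rounds.\<close>

lemma hoare_rounds:
  assumes E: "41 \<le> E" and es: "set es \<subseteq> {41..<E} \<times> {41..<E} \<times> UNIV"
  shows "hoare (\<lambda>m. bf_state E es x m \<and> m 22 = int (Suc n)) (while_pos 22 relax_round)
    (Suc n * (8 + 18 * length es) + 1)
    (\<lambda>m. m 9 = 1 \<and> m 26 = of_bool (\<exists>e\<in>set es. \<not> sat e ((fold relax es ^^ n) x)))"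
proof -
  define I where "I k m \<longleftrightarrow> k \<le> Suc n \<and> bf_state E es ((fold relax es ^^ (Suc n - k)) x) m \<and>
    m 22 = int k \<and> (k \<le> n \<longrightarrow> m 26 = of_bool (\<exists>e\<in>set es. \<not> sat e ((fold relax es ^^ (n - k)) x)))" for k m
  have "hoare (I (Suc n)) (while_pos 22 relax_round) (Suc n * (5 + 18 * length es + 3) + 1) (I 0)"
  proof (rule hoare_while)
    fix k assume k: "k < Suc n"
    then have s: "Suc n - k = Suc (n - k)" by simp
    show "hoare (I (Suc k)) relax_round (5 + 18 * length es) (\<lambda>m. I k (m(0 := 0)))"
    proof (rule hoare_weaken[OF hoare_relax_round[OF E es, of "(fold relax es ^^ (n - k)) x" "int (Suc k)"]])
      fix m assume m: "bf_state E es (fold relax es ((fold relax es ^^ (n - k)) x)) m \<and>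
         m 22 = int (Suc k) - 1 \<and> m 26 = of_bool (\<exists>e\<in>set es. \<not> sat e ((fold relax es ^^ (n - k)) x))"
      have "m(0 := 0) = m" using m by (auto simp: bf_state_def)
      moreover have "I k m" unfolding I_def s using m k by simp
      ultimately show "I k (m(0 := 0))" by simp
    qed (auto simp: I_def)
  qed (auto simp: I_def)
  then show ?thesis
    by (rule hoare_weaken) (auto simp: I_def bf_state_def)
qed

section \<open>The complete program\<close>

text \<open>The input is moved up by 32 cells, starting with its last cell, to free the registers 9 to 40.\<close>

definition move_code :: frag where
  "move_code = (\<lambda>_. [Add 8 1 1]) ;; while_pos 8
     (\<lambda>_. [LoadC 7 8, Add 7 7 8, LoadI 0 7, LoadC 7 40, Add 7 7 8, StoreI 7 0, LoadC 7 (-1), Add 8 8 7])"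

lemma hoare_move:
  assumes M: "M 0 = 0" "M 1 = int D"
  shows "hoare (\<lambda>m. m = M) move_code (2 + 22 * D)
    (\<lambda>m. m 0 = 0 \<and> (\<forall>r\<in>{1..6}. m r = M r) \<and> (\<forall>j. 9 \<le> j \<and> j \<le> 2 * D + 8 \<longrightarrow> m (j + 32) = M j))"
proof -
  \<comment> \<open>Cells up to k + 8 are still in place and those above have been copied. The next
    write goes to cell k + 40, beyond every cell that remains to be read.\<close>
  define I where "I k m \<longleftrightarrow> k \<le> 2 * D \<and> m 0 = 0 \<and> (\<forall>r\<in>{1..6}. m r = M r) \<and> m 8 = int k \<and>
     (\<forall>j. 9 \<le> j \<and> j \<le> k + 8 \<longrightarrow> m j = M j) \<and> (\<forall>j. k + 8 < j \<and> j \<le> 2 * D + 8 \<longrightarrow> m (j + 32) = M j)" for k m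
  let ?body = "[LoadC 7 8, Add 7 7 8, LoadI 0 7, LoadC 7 40, Add 7 7 8, StoreI 7 0, LoadC 7 (-1), Add 8 8 7]"
  have "hoare (\<lambda>m. m = M) (\<lambda>_. [Add 8 1 1]) (length [Add 8 1 1]) (I (2 * D))"
    using M by (intro hoare_basic) (auto simp: I_def eff_def)
  moreover have "hoare (I (2 * D)) (while_pos 8 (\<lambda>_. ?body)) (2 * D * (8 + 3) + 1) (I 0)"
  proof (rule hoare_while)
    fix k
    show "hoare (I (Suc k)) (\<lambda>_. ?body) 8 (\<lambda>m. I k (m(0 := 0)))"
    proof (rule hoare_basic')
      fix m assume m: "I (Suc k) m"
      have m': "m 8 = 1 + int k" "m 0 = 0" using m by (auto simp: I_def)
      have n: "nat (9 + int k) = k + 9" "nat (41 + int k) = k + 41" by auto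
      let ?m = "m(0 := m (k + 9), 7 := -1, k + 41 := m (k + 9), 8 := int k)"
      have "fold eff ?body m = ?m"
        using m' by (auto simp: eff_def fun_eq_iff n)
      moreover have "I k (?m(0 := 0))"
        unfolding I_def
      proof (intro conjI)
        show "\<forall>j. k + 8 < j \<and> j \<le> 2 * D + 8 \<longrightarrow> (?m(0 := 0)) (j + 32) = M j"
        proof (intro allI impI)
          fix j assume "k + 8 < j \<and> j \<le> 2 * D + 8"
          then show "(?m(0 := 0)) (j + 32) = M j"
            using m by (cases "j = k + 9") (auto simp: I_def)
        qed
      qed (use m in \<open>auto simp: I_def\<close>)
      ultimately show "I k ((fold eff ?body m)(0 := 0))" by simp
    qed auto
  qed (auto simp: I_def)
  ultimately have "hoare (\<lambda>m. m = M) move_code (length [Add 8 1 1] + (2 * D * (8 + 3) + 1)) (I 0)"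
    unfolding move_code_def by (rule hoare_seq)
  then show ?thesis by (rule hoare_weaken) (auto simp: I_def)
qed

text \<open>The unknowns a d and b d are kept in the cells va d and vb d, followed by the edges.\<close>

definition va :: "nat \<Rightarrow> nat \<Rightarrow> nat" where "va D d = 41 + 2 * D + 2 * d"
definition vb :: "nat \<Rightarrow> nat \<Rightarrow> nat" where "vb D d = 42 + 2 * D + 2 * d"

section \<open>The constraint graph\<close>

definition boundary_edges :: "nat \<Rightarrow> nat \<Rightarrow> (nat \<times> nat \<times> int) list" where
  "boundary_edges D N =
    [(vb D 1, va D 0, 0), (va D 0, vb D 1, 0), (va D 1, vb D 0, - int N), (vb D 0, va D 1, int N),
     (va D D, vb D (D + 1), 0), (vb D (D + 1), va D D, 0),
     (vb D D, va D (D + 1), int N), (va D (D + 1), vb D D, - int N)]"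

definition day_edges ::
  "nat \<Rightarrow> nat \<Rightarrow> nat \<Rightarrow> nat \<Rightarrow> nat \<Rightarrow> nat \<Rightarrow> (nat \<Rightarrow> nat) \<Rightarrow> (nat \<Rightarrow> nat) \<Rightarrow> nat \<Rightarrow> (nat \<times> nat \<times> int) list" where
  "day_edges D N lw uw lo uo rl ru d =
    [(va D (d - 1), vb D (min (d - 1 + max lw 1) (D + 1)), 0),
     (vb D (min (d + uw) (D + 1)), va D d, 0),
     (vb D (d - 1), va D (min (d - 1 + max lo 1) (D + 1)), int N),
     (va D (min (d + uo) (D + 1)), vb D d, - int N),
     (va D d, va D (d - 1), 0), (vb D d, vb D (d - 1), 0),
     (vb D d, va D d, int (ru d)), (va D d, vb D d, - int (rl d))]"

definition edges_upto ::
  "nat \<Rightarrow> nat \<Rightarrow> nat \<Rightarrow> nat \<Rightarrow> nat \<Rightarrow> nat \<Rightarrow> (nat \<Rightarrow> nat) \<Rightarrow> (nat \<Rightarrow> nat) \<Rightarrow> nat \<Rightarrow> (nat \<times> nat \<times> int) list" where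
  "edges_upto D N lw uw lo uo rl ru n =
     boundary_edges D N @ concat (map (day_edges D N lw uw lo uo rl ru) [1..<Suc n])"

lemma edges_upto_Suc:
  "edges_upto D N lw uw lo uo rl ru (Suc n) =
     edges_upto D N lw uw lo uo rl ru n @ day_edges D N lw uw lo uo rl ru (Suc n)"
  by (simp add: edges_upto_def)

lemma set_edges_upto:
  "set (edges_upto D N lw uw lo uo rl ru n) =
     set (boundary_edges D N) \<union> (\<Union>d\<in>{1..n}. set (day_edges D N lw uw lo uo rl ru d))"
  by (auto simp: edges_upto_def)

lemma length_edges_upto: "length (edges_upto D N lw uw lo uo rl ru n) = 8 + 8 * n"
  by (induction n) (simp_all add: edges_upto_Suc, simp_all add: edges_upto_def boundary_edges_def day_edges_def)

lemma sat_edges_iff: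
  "(\<forall>e\<in>set (edges_upto D N lw uw lo uo rl ru D). sat e y) \<longleftrightarrow>
     count_system D N lw uw lo uo rl ru (\<lambda>d. y (va D d)) (\<lambda>d. y (vb D d))"
proof -
  have b: "(\<forall>e\<in>set (boundary_edges D N). sat e y) \<longleftrightarrow>
    y (va D 0) = y (vb D 1) \<and> y (vb D (D + 1)) = y (va D D) \<and>
    y (vb D 0) + int N = y (va D 1) \<and> y (va D (D + 1)) = y (vb D D) + int N"
    unfolding boundary_edges_def by auto
  have d: "(\<forall>e\<in>set (day_edges D N lw uw lo uo rl ru d). sat e y) \<longleftrightarrow>
    (y (vb D (min (d - 1 + max lw 1) (D + 1))) \<le> y (va D (d - 1)) \<and>
     y (va D d) \<le> y (vb D (min (d + uw) (D + 1))) \<and> y (va D (d - 1)) \<le> y (va D d)) \<and>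
    (y (va D (min (d - 1 + max lo 1) (D + 1))) \<le> y (vb D (d - 1)) + int N \<and>
     y (vb D d) + int N \<le> y (va D (min (d + uo) (D + 1))) \<and> y (vb D (d - 1)) + int N \<le> y (vb D d) + int N) \<and>
    (y (va D d) \<le> y (vb D d) + int (ru d) \<and> y (vb D d) \<le> y (va D d) - int (rl d))" for d
    unfolding day_edges_def by auto
  show ?thesis
    unfolding set_edges_upto ball_Un ball_UN b d count_system_def half_def ball_conj_distrib by argo
qed

lemma count_system_iff_sat:
  "(\<exists>a b. count_system D N lw uw lo uo rl ru a b) \<longleftrightarrow>
     (\<exists>y. \<forall>e\<in>set (edges_upto D N lw uw lo uo rl ru D). sat e y)"
proof
  assume "\<exists>a b. count_system D N lw uw lo uo rl ru a b"
  then obtain a b where ab: "count_system D N lw uw lo uo rl ru a b" by blast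
  \<comment> \<open>The cells \<open>va\<close> have odd and the cells \<open>vb\<close> even
    addresses, so parity and halving decode a cell.\<close>
  define y where "y v = (if odd v then a ((v - 41 - 2 * D) div 2) else b ((v - 42 - 2 * D) div 2))" for v
  have "(\<lambda>d. y (va D d)) = a" "(\<lambda>d. y (vb D d)) = b"
    by (auto simp: y_def va_def vb_def fun_eq_iff)
  then show "\<exists>y. \<forall>e\<in>set (edges_upto D N lw uw lo uo rl ru D). sat e y"
    using ab unfolding sat_edges_iff by (intro exI[of _ y]) simp
qed (auto simp only: sat_edges_iff)

text \<open>The interval consists of exactly the 2D + 4 cells of the unknowns; its size becomes the
  number of rounds.\<close>

lemma edges_range:
  "set (edges_upto D N lw uw lo uo rl ru D) \<subseteq> {41 + 2 * D..<45 + 4 * D} \<times> {41 + 2 * D..<45 + 4 * D} \<times> UNIV"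
  unfolding set_edges_upto boundary_edges_def day_edges_def va_def vb_def by (auto simp: min_def)

text \<open>Consecutive days are two cells apart, so the length bounds are doubled once and for all.
  Register 11 points to the cell \<open>va\<close> of the previous day, 12 to that of day D + 1 and
  13 into the input; 15 counts the days left and 21 holds -N.\<close>

definition setup_ops :: "gop list" where
  "setup_ops =
    [Maximum 3 9, Maximum 5 9, Plus 3 3 3, Plus 4 4 4, Plus 5 5 5, Plus 6 6 6, Minus 21 0 2, Plus 10 1 1,
     Const 11 41, Plus 11 11 10, Const 13 41, Const 12 43, Plus 12 12 10, Plus 12 12 10, Plus 15 1 0,
     Plus 16 11 9, Plus 17 16 9, Plus 18 17 9,
     Emit 18 11 0, Emit 11 18 0, Emit 17 16 21, Emit 16 17 2,
     Plus 20 12 9, Minus 19 12 9, Minus 18 19 9,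
     Emit 18 20 0, Emit 20 18 0, Emit 19 12 2, Emit 12 19 21]"

text \<open>Truncation at day D + 1 is a minimum of addresses of \<open>va\<close> cells; where a
  \<open>vb\<close> cell is meant, 1 is added afterwards.\<close>

definition day_ops :: "gop list" where
  "day_ops =
    [Plus 16 11 9, Plus 17 16 9, Plus 18 17 9,
     Plus 19 11 3, Minimum 19 12, Plus 19 19 9, Emit 11 19 0,
     Plus 19 17 4, Minimum 19 12, Plus 19 19 9, Emit 19 17 0,
     Plus 19 11 5, Minimum 19 12, Emit 16 19 2,
     Plus 19 17 6, Minimum 19 12, Emit 19 18 21,
     Emit 17 11 0, Emit 18 16 0,
     Load 19 13, Plus 13 13 9, Load 20 13, Plus 13 13 9,
     Emit 18 17 20, Minus 19 0 19, Emit 17 18 19,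
     Plus 11 17 0, Minus 15 15 9]"

definition day_regs :: "nat \<Rightarrow> nat \<Rightarrow> nat \<Rightarrow> nat \<Rightarrow> nat \<Rightarrow> nat \<Rightarrow> nat \<Rightarrow> mem \<Rightarrow> bool" where
  "day_regs D N lw uw lo uo n R \<longleftrightarrow> R 0 = 0 \<and> R 1 = int D \<and> R 2 = int N \<and>
     R 3 = 2 * int (max lw 1) \<and> R 4 = 2 * int uw \<and> R 5 = 2 * int (max lo 1) \<and> R 6 = 2 * int uo \<and> R 9 = 1 \<and>
     R 11 = int (va D n) \<and> R 12 = int (va D (D + 1)) \<and> R 13 = int (41 + 2 * n) \<and> R 15 = int D - int n \<and>
     R 21 = - int N"

lemma setup_ops_correct:
  assumes "R 0 = 0" "R 1 = int D" "R 2 = int N" "R 3 = int lw" "R 4 = int uw" "R 5 = int lo" "R 6 = int uo"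
    "R 9 = 1"
  shows "gops_ok E H setup_ops R" "day_regs D N lw uw lo uo 0 (gops_regs H setup_ops R)"
    "gops_emitted H setup_ops R = edges_upto D N lw uw lo uo rl ru 0"
proof -
  show "gops_ok E H setup_ops R"
    by (simp add: setup_ops_def src_def dst_def)
  show "day_regs D N lw uw lo uo 0 (gops_regs H setup_ops R)"
    using assms by (auto simp: setup_ops_def day_regs_def va_def)
  show "gops_emitted H setup_ops R = edges_upto D N lw uw lo uo rl ru 0"
    using assms by (simp add: setup_ops_def edges_upto_def boundary_edges_def va_def vb_def nat_eq_iff)
qed

lemma va_min: "int (va D (min x (D + 1))) = min (int (va D x)) (int (va D (D + 1)))"
  by (simp add: va_def min_def)

lemma day_ops_correct:
  assumes R: "day_regs D N lw uw lo uo n R" and n: "n < D"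
    and H: "H (41 + 2 * n) = int (rl (Suc n))" "H (42 + 2 * n) = int (ru (Suc n))"
  shows "gops_ok (45 + 4 * D) H day_ops R" "day_regs D N lw uw lo uo (Suc n) (gops_regs H day_ops R)"
    "gops_emitted H day_ops R = day_edges D N lw uw lo uo rl ru (Suc n)"
proof -
  have r: "R 0 = 0" "R 1 = int D" "R 2 = int N" "R 3 = 2 * max (int lw) 1" "R 4 = 2 * int uw"
    "R 5 = 2 * max (int lo) 1" "R 6 = 2 * int uo" "R 9 = 1" "R 11 = int (va D n)"
    "R 12 = int (va D (D + 1))" "R 13 = int (41 + 2 * n)" "R 15 = int D - int n" "R 21 = - int N"
    using R by (auto simp: day_regs_def)
  have m: "min (int (va D n) + 2 * int k) (int (va D (D + 1))) = int (va D (min (n + k) (D + 1)))"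
    "min (int (va D n) + 2 + 2 * int k) (int (va D (D + 1))) = int (va D (min (Suc n + k) (D + 1)))" for k
    unfolding va_min by (simp_all add: va_def algebra_simps)
  have a: "nat (41 + 2 * int n) = 41 + 2 * n" "nat (42 + 2 * int n) = 42 + 2 * n" by auto
  have v: "int (va D n) + 1 + 1 = int (va D n) + 2" by simp
  have v': "nat (int (va D d)) = va D d" "nat (int (va D d) + 1) = vb D d"
    "nat (int (va D n) + 2) = va D (Suc n)" "nat (int (va D n) + 2 + 1) = vb D (Suc n)" for d
    by (auto simp: va_def vb_def)
  show "gops_ok (45 + 4 * D) H day_ops R"
    using n by (simp add: day_ops_def src_def dst_def r a)
  show "day_regs D N lw uw lo uo (Suc n) (gops_regs H day_ops R)"
    unfolding day_regs_def using n r(2) by (simp add: day_ops_def r) (auto simp: va_def)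
  show "gops_emitted H day_ops R = day_edges D N lw uw lo uo rl ru (Suc n)"
    unfolding day_ops_def day_edges_def
    by (simp add: r a H) (auto simp: va_def vb_def min_def max_def nat_eq_iff)
qed

definition generate_code :: frag where
  "generate_code = (\<lambda>_. [LoadC 9 1, LoadC 14 45, Add 14 14 1, Add 14 14 1, Add 14 14 1, Add 14 14 1]) ;;
     gops_code setup_ops ;; while_pos 15 (gops_code day_ops)"

lemma hoare_generate:
  assumes "M 0 = 0" "M 1 = int D" "M 2 = int N" "M 3 = int lw" "M 4 = int uw" "M 5 = int lo" "M 6 = int uo"
    and inp: "\<And>d. d \<in> {1..D} \<Longrightarrow> M (2 * d + 7) = int (rl d) \<and> M (2 * d + 8) = int (ru d)"
  shows "hoare (\<lambda>m. m 0 = 0 \<and> (\<forall>r\<in>{1..6}. m r = M r) \<and> (\<forall>j. 9 \<le> j \<and> j \<le> 2 * D + 8 \<longrightarrow> m (j + 32) = M j))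
    generate_code (181 + 171 * D)
    (\<lambda>m. m 0 = 0 \<and> m 1 = int D \<and> m 9 = 1 \<and> m 14 = int (45 + 4 * D + 3 * (8 + 8 * D)) \<and>
       edges_at (45 + 4 * D) (edges_upto D N lw uw lo uo rl ru D) m)"
    (is "hoare ?P _ _ ?Q")
proof -
  let ?E = "45 + 4 * D" and ?es = "edges_upto D N lw uw lo uo rl ru"
  let ?init = "[LoadC 9 1, LoadC 14 45, Add 14 14 1, Add 14 14 1, Add 14 14 1, Add 14 14 1]"
  \<comment> \<open>Fixing the initial memory lets one \<open>H\<close> describe the input cells
    during the whole generation.\<close>
  have "hoare (\<lambda>x. x = m) generate_code (181 + 171 * D) ?Q" if m: "?P m" for m
  proof -
    have ml: "m (j + 32) = M j" if "9 \<le> j" "j \<le> 2 * D + 8" for j using m that by blast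
    define H where "H = fold eff ?init m"
    have H: "H = m(9 := 1, 14 := int ?E)"
      using m assms(2) by (auto simp: H_def eff_def fun_eq_iff)
    define R where "R = gops_regs H setup_ops H"
    define I where "I k x \<longleftrightarrow> k \<le> D \<and> (\<exists>R. day_regs D N lw uw lo uo (D - k) R \<and> gen_state ?E H R (?es (D - k)) x)" for k x
    have hdr: "H 0 = 0" "H 1 = int D" "H 2 = int N" "H 3 = int lw" "H 4 = int uw" "H 5 = int lo" "H 6 = int uo" "H 9 = 1"
      using m assms by (auto simp: H)
    have day: "H (41 + 2 * n) = int (rl (Suc n))" "H (42 + 2 * n) = int (ru (Suc n))" if "n < D" for n
    proof -
      have "m (2 * Suc n + 7 + 32) = M (2 * Suc n + 7)" "m (2 * Suc n + 8 + 32) = M (2 * Suc n + 8)"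
        by (rule ml; use that in simp)+
      then show "H (41 + 2 * n) = int (rl (Suc n))" "H (42 + 2 * n) = int (ru (Suc n))"
        using inp[of "Suc n"] that by (simp_all add: H)
    qed
    have "hoare (\<lambda>x. x = m) (\<lambda>_. ?init) (length ?init) (gen_state ?E H H [])"
    proof (intro hoare_basic)
      show "gen_state ?E H H [] (fold eff ?init x)" if "x = m" for x
        unfolding that H_def[symmetric] using hdr by (simp add: gen_state_def edges_at_def) (simp add: H)
    qed simp
    moreover have "hoare (gen_state ?E H H []) (gops_code setup_ops) (6 * length setup_ops)
      (gen_state ?E H R (?es 0))"
      using hoare_gops[of ?E H setup_ops H "[]"] setup_ops_correct(1)[OF hdr]
      unfolding R_def setup_ops_correct(3)[OF hdr, of H rl ru] by simp
    then have "hoare (gen_state ?E H H []) (gops_code setup_ops) (6 * length setup_ops) (I D)"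
      using setup_ops_correct(2)[OF hdr] unfolding I_def R_def
      by (elim hoare_weaken) auto
    moreover have "hoare (I D) (while_pos 15 (gops_code day_ops)) (D * (6 * length day_ops + 3) + 1) (I 0)"
    proof (rule hoare_while)
      fix k assume k: "k < D"
      then have n: "D - Suc k < D" "D - k = Suc (D - Suc k)" by auto
      have "\<exists>t\<le>6 * length day_ops. \<exists>y. reaches (gops_code day_ops) x t y \<and> I k (y(0 := 0))"
        if x: "I (Suc k) x" for x
      proof -
        obtain R where R: "day_regs D N lw uw lo uo (D - Suc k) R" "gen_state ?E H R (?es (D - Suc k)) x"
          using x unfolding I_def by blast
        note c = day_ops_correct[of D N lw uw lo uo _ R H rl ru, OF R(1) n(1) day[OF n(1)]]
        obtain t y where y: "t \<le> 6 * length day_ops" "reaches (gops_code day_ops) x t y"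
          "gen_state ?E H (gops_regs H day_ops R) (?es (D - Suc k) @ gops_emitted H day_ops R) y"
          using hoare_gops[OF _ c(1), unfolded hoare_def, rule_format, OF _ R(2)] by auto
        have "y(0 := 0) = y" using y(3) by (auto simp: gen_state_def)
        moreover have "I k y"
          unfolding I_def n(2) edges_upto_Suc using y(3) c(2,3) k by auto
        ultimately show ?thesis using y by metis
      qed
      then show "hoare (I (Suc k)) (gops_code day_ops) (6 * length day_ops) (\<lambda>m. I k (m(0 := 0)))"
        unfolding hoare_def by blast
    next
      show "x 15 > 0" if "I (Suc k) x" for k x
        using that by (auto simp: I_def gen_state_def day_regs_def)
      show "x 15 \<le> 0" if "I 0 x" for x
        using that by (auto simp: I_def gen_state_def day_regs_def)
    qed
    ultimately have "hoare (\<lambda>x. x = m) generate_code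
      (length ?init + (6 * length setup_ops + (D * (6 * length day_ops + 3) + 1))) (I 0)"
      unfolding generate_code_def by (intro hoare_seq)
    then show ?thesis
    proof (rule hoare_weaken)
      show "?Q x" if "I 0 x" for x
        using that by (auto simp: I_def gen_state_def day_regs_def length_edges_upto)
    qed (auto simp: setup_ops_def day_ops_def)
  qed
  then show ?thesis unfolding hoare_def by blast
qed

section \<open>Assembly and running time\<close>

definition ldodosp_code :: frag where
  "ldodosp_code = move_code ;; generate_code ;;
     (\<lambda>_. [LoadC 25 45, Add 25 25 1, Add 25 25 1, Add 25 25 1, Add 25 25 1, LoadC 22 5, Add 22 22 1, Add 22 22 1]) ;;
     while_pos 22 relax_round ;; (\<lambda>_. [Sub 0 9 26])"

lemma hoare_ldodosp:
  assumes inst: "valid_instance D N lw uw lo uo D D rl ru"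
  shows "hoare (\<lambda>m. m = input_mem D N lw uw lo uo D D rl ru) ldodosp_code (2458 * D ^ 2)
    (\<lambda>m. m 0 = (if DODOSP_yes D N lw uw lo uo D D rl ru then 1 else 0))"
proof -
  let ?M = "input_mem D N lw uw lo uo D D rl ru"
  let ?E = "45 + 4 * D" and ?es = "edges_upto D N lw uw lo uo rl ru D"
  let ?n = "2 * D + 4"
  let ?init = "[LoadC 25 45, Add 25 25 1, Add 25 25 1, Add 25 25 1, Add 25 25 1, LoadC 22 5, Add 22 22 1, Add 22 22 1]"
  let ?G = "\<lambda>m. m 0 = 0 \<and> m 1 = int D \<and> m 9 = 1 \<and> m 14 = int (?E + 3 * (8 + 8 * D)) \<and> edges_at ?E ?es m"
  have D: "1 \<le> D" using inst by (simp add: valid_instance_def)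
  have inp: "?M (2 * d + 7) = int (rl d) \<and> ?M (2 * d + 8) = int (ru d)" if "d \<in> {1..D}" for d
    using that by (auto simp: input_mem_def)
  have range: "set ?es \<subseteq> {41..<?E} \<times> {41..<?E} \<times> UNIV"
    using edges_range[of D N lw uw lo uo rl ru] by fastforce
  have card: "card {41 + 2 * D..<45 + 4 * D} = ?n" by simp
  have yes: "of_bool (\<exists>e\<in>set ?es. \<not> sat e ((fold relax ?es ^^ ?n) x)) =
      (if DODOSP_yes D N lw uw lo uo D D rl ru then 0 else 1 :: int)" for x
    using DODOSP_yes_iff_count_system[OF inst] count_system_iff_sat[of D N lw uw lo uo rl ru]
      bellman_ford[OF _ edges_range[of D N lw uw lo uo rl ru], of x, unfolded card] by auto
  have 1: "hoare (\<lambda>m. m = ?M) move_code (2 + 22 * D)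
    (\<lambda>m. m 0 = 0 \<and> (\<forall>r\<in>{1..6}. m r = ?M r) \<and> (\<forall>j. 9 \<le> j \<and> j \<le> 2 * D + 8 \<longrightarrow> m (j + 32) = ?M j))"
    by (rule hoare_move) (simp_all add: input_mem_def)
  have 2: "hoare (\<lambda>m. m 0 = 0 \<and> (\<forall>r\<in>{1..6}. m r = ?M r) \<and> (\<forall>j. 9 \<le> j \<and> j \<le> 2 * D + 8 \<longrightarrow> m (j + 32) = ?M j))
    generate_code (181 + 171 * D) ?G"
    by (rule hoare_generate[OF _ _ _ _ _ _ _ inp]) (simp_all add: input_mem_def)
  have "hoare (\<lambda>y. y = m) ((\<lambda>_. ?init) ;; while_pos 22 relax_round) (length ?init + (Suc ?n * (8 + 18 * length ?es) + 1))
    (\<lambda>y. y 9 = 1 \<and> y 26 = (if DODOSP_yes D N lw uw lo uo D D rl ru then 0 else 1))" if m: "?G m" for m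
  proof (rule hoare_seq)
    let ?m = "m(25 := int ?E, 22 := 5 + 2 * int D)"
    have eq: "fold eff ?init m = ?m" using m by (auto simp: eff_def fun_eq_iff)
    have "edges_at ?E ?es ?m" using m by (auto intro: edges_at_cong)
    \<comment> \<open>The memory itself is taken as the start vector, whatever the cells of the
      unknowns contain.\<close>
    then have "bf_state ?E ?es ?m ?m" using m by (simp add: bf_state_def length_edges_upto)
    then show "hoare (\<lambda>y. y = m) (\<lambda>_. ?init) (length ?init) (\<lambda>y. bf_state ?E ?es ?m y \<and> y 22 = int (Suc ?n))"
      using eq by (intro hoare_basic) auto
    show "hoare (\<lambda>y. bf_state ?E ?es ?m y \<and> y 22 = int (Suc ?n)) (while_pos 22 relax_round)
      (Suc ?n * (8 + 18 * length ?es) + 1)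
      (\<lambda>y. y 9 = 1 \<and> y 26 = (if DODOSP_yes D N lw uw lo uo D D rl ru then 0 else 1))"
      using hoare_rounds[OF _ range, of ?m ?n] unfolding yes by simp
  qed
  then have 3: "hoare ?G ((\<lambda>_. ?init) ;; while_pos 22 relax_round) (length ?init + (Suc ?n * (8 + 18 * length ?es) + 1))
    (\<lambda>y. y 9 = 1 \<and> y 26 = (if DODOSP_yes D N lw uw lo uo D D rl ru then 0 else 1))"
    unfolding hoare_def by blast
  have 4: "hoare (\<lambda>y. y 9 = 1 \<and> y 26 = (if DODOSP_yes D N lw uw lo uo D D rl ru then 0 else 1))
    (\<lambda>_. [Sub 0 9 26]) (length [Sub 0 9 26]) (\<lambda>m. m 0 = (if DODOSP_yes D N lw uw lo uo D D rl ru then 1 else 0))"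
    by (intro hoare_basic) (auto simp: eff_def)
  \<comment> \<open>The start vector depends on the memory before the initialisation, so
    initialisation and loop were verified together for a fixed memory; the program is regrouped
    accordingly.\<close>
  have assoc: "(a ;; b) ;; c = a ;; b ;; c" for a b c
    by (simp add: seq_def fun_eq_iff add.assoc)
  have 5: "hoare (\<lambda>m. m = ?M) ldodosp_code
    ((2 + 22 * D) + ((181 + 171 * D) + ((length ?init + (Suc ?n * (8 + 18 * length ?es) + 1)) + length [Sub 0 9 26])))
    (\<lambda>m. m 0 = (if DODOSP_yes D N lw uw lo uo D D rl ru then 1 else 0))"
    unfolding ldodosp_code_def assoc[symmetric, of "\<lambda>_. ?init"]
    by (intro hoare_seq[OF 1] hoare_seq[OF 2] hoare_seq[OF 3] 4)
  \<comment> \<open>The sum is 288 D^2 + 1217 D + 953, and 2458 is the sum of these coefficients, as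
    D and 1 are at most D^2.\<close>
  have 6: "(2 + 22 * D) + ((181 + 171 * D) + ((length ?init + (Suc ?n * (8 + 18 * length ?es) + 1)) + length [Sub 0 9 26]))
    \<le> 2458 * D ^ 2"
  proof -
    have "D \<le> D ^ 2" "1 \<le> D ^ 2" using D by (auto simp: power2_eq_square)
    moreover have "Suc ?n * (8 + 18 * length ?es) = 288 * D ^ 2 + 1024 * D + 760"
      by (simp add: length_edges_upto power2_eq_square algebra_simps)
    ultimately show ?thesis by simp
  qed
  show ?thesis by (rule hoare_weaken[OF 5 _ 6])
qed

theorem theorem5p1:
  shows "\<exists>(prog :: instr list) (c :: nat).
     \<forall>D N lw uw lo uo Uw Uo rl ru.
       valid_instance D N lw uw lo uo Uw Uo rl ru \<and> Uw = D \<and> Uo = D \<longrightarrow>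
       (\<exists>k \<le> c * D ^ 2.
          halted prog (run prog k (0, input_mem D N lw uw lo uo Uw Uo rl ru)) \<and>
          snd (run prog k (0, input_mem D N lw uw lo uo Uw Uo rl ru)) 0 =
            (if DODOSP_yes D N lw uw lo uo Uw Uo rl ru then 1 else 0))"
  using hoare_halts[OF hoare_ldodosp refl] by blast

end
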